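(* Let $\boldsymbol{\mathcal{A}}=(\mathcal{A}_0,\dots,\mathcal{A}_n)$ be a family of nonempty finite subsets of a lattice $M$ of rank $n$, let $\boldsymbol{\rho}=(\rho_0,\dots,\rho_n)$ be a family of convex piecewise affine functions $\rho_i\colon\Delta_i\to\mathbb{R}$ defined on $\mathcal{A}_i$, with $\Delta_i=\operatorname{conv}(\mathcal{A}_i)$, whose inf-convolution $\rho$ induces a tight mixed subdivision $S(\rho)$ of $\Delta=\sum_i\Delta_i$, and let $\delta\in M_{\mathbb{R}}$ be generic with respect to $S(\rho)$. Let $\phi_i\colon\Delta_i\to\mathbb{R}$, $i=0,\dots,n$, be another family of convex piecewise affine functions with inf-convolution $\phi\colon\Delta\to\mathbb{R}$, and suppose that $S(\phi)\preceq S(\rho)$. Then for $\boldsymbol{\omega}=(\phi_i(a))_{i\in\{0,\dots,n\},a\in\mathcal{A}_i}\in\mathbb{R}^{\boldsymbol{\mathcal{A}}}$ we have that $$\operatorname{init}_{\boldsymbol{\omega}}(\det(\mathcal{H}_{\boldsymbol{\mathcal{A}},\boldsymbol{\rho}}))=\prod_D\det(\mathcal{H}_{\boldsymbol{\mathcal{A}}_D,\boldsymbol{\rho}_D}),$$ the product being over the $n$-cells $D$ of $S(\phi)$.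
   Context: Polyhedral notation. $M\simeq\mathbb{Z}^n$, $N=\operatorname{Hom}(M,\mathbb{Z})$, $M_{\mathbb{R}}=M\otimes\mathbb{R}$, $N_{\mathbb{R}}=N\otimes\mathbb{R}$. For a convex piecewise affine function $\rho\colon\Delta\to\mathbb{R}$ on a polytope and $v\in N_{\mathbb{R}}$ put $\Gamma(\rho,v)=\{x\in\Delta\mid \rho(x)+\langle v,x\rangle=\min_{y\in\Delta}(\rho(y)+\langle v,y\rangle)\}$. The subdivision $S(\rho)$ of $\Delta$ is the collection of all the sets $\Gamma(\rho,v)$, called cells; an $n$-cell is a cell of dimension $n$. The inf-convolution of $\rho_i\colon\Delta_i\to\mathbb{R}$, $i=0,\dots,n$, is $\rho=\boxplus_i\rho_i\colon\Delta=\sum_i\Delta_i\to\mathbb{R}$, $\rho(x)=\inf\{\sum_i\rho_i(x_i)\mid x_i\in\Delta_i,\sum_ix_i=x\}$, and $S(\rho)$ is called a mixed subdivision of $\Delta$. The $i$-th component of $C\in S(\rho)$ is the set $C_i$ of $x_i\in\Delta_i$ for which there are $x_j\in\Delta_j$, $j\ne i$, with $\sum_jx_j\in C$ and $\rho(\sum_jx_j)=\sum_j\rho_j(x_j)$; if $C=\Gamma(\rho,v)$ then $C_i=\Gamma(\rho_i,v)$. $S(\rho)$ is tight if $\sum_{i}\dim(C_i)=n$ for every $n$-cell $C$. One writes $S(\phi)\preceq S(\rho)$ if for every $C\in S(\rho)$ there is $D\in S(\phi)$ with $C\subset D$ and $C_i\subset D_i$ for all $i$. The function $\rho_i$ is defined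 on $\mathcal{A}_i$ if there is $\boldsymbol{\nu}_i\in\mathbb{R}^{\mathcal{A}_i}$ such that $\rho_i(x)=\min\{z\mid(x,z)\in\operatorname{conv}\{(a,\nu_{i,a})\}_{a\in\mathcal{A}_i}\}$ for all $x\in\Delta_i$. Genericity of $\delta$: $(|S(\rho)^{n-1}|+\delta)\cap M=\emptyset$, where $|S(\rho)^{n-1}|$ is the $(n-1)$-skeleton of $S(\rho)$, i.e. the union of its cells of dimension at most $n-1$. Canny-Emiris matrix. Let $\boldsymbol{u}_i=\{u_{i,a}\}_{a\in\mathcal{A}_i}$ be variables, $\boldsymbol{u}=(\boldsymbol{u}_0,\dots,\boldsymbol{u}_n)$ and $\mathbb{K}=\mathbb{C}(\boldsymbol{u})$. The index set is $\mathcal{B}=(\Delta+\delta)\cap M$. Each $b\in\mathcal{B}$ lies in $C+\delta$ for a unique $n$-cell $C$ of $S(\rho)$; let $i(b)$ be the largest $i$ with $\dim(C_i)=0$, and $a(b)\in\mathcal{A}_{i(b)}$ the unique point of $C_{i(b)}$. The Canny-Emiris matrix $\mathcal{H}_{\boldsymbol{\mathcal{A}},\boldsymbol{\rho}}\in\mathbb{K}^{\mathcal{B}\times\mathcal{B}}$ (depending also on the fixed $\delta$) has entry at $(b,b')$ equal to $u_{i(b),\,b'-b+a(b)}$ if $b'-b+a(b)\in\mathcal{A}_{i(b)}$, and $0$ otherwise. An empty matrix has determinant $1$. Restriction. For an $n$-cell $D$ of $S(\phi)$ with components $D_0,\dots,D_n$ set $\boldsymbol{\mathcal{A}}_D=(\mathcal{A}_0\cap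 D_0,\dots,\mathcal{A}_n\cap D_n)$ and $\boldsymbol{\rho}_D=(\rho_0|_{D_0},\dots,\rho_n|_{D_n})$. The data $(\boldsymbol{\mathcal{A}}_D,\boldsymbol{\rho}_D,\delta)$ satisfies the hypotheses of the construction above (with $\Delta$ replaced by $D$), and $\mathcal{H}_{\boldsymbol{\mathcal{A}}_D,\boldsymbol{\rho}_D}$ is its Canny-Emiris matrix, in the variables $u_{i,a}$, $a\in\mathcal{A}_i\cap D_i$. Initial part. For $0\ne P\in\mathbb{C}[\boldsymbol{u}]$, $\operatorname{init}_{\boldsymbol{\omega}}(P)$ is the sum of the monomial terms of $P$ whose exponents $\boldsymbol{c}$ have minimal weight $\sum_{i,a}\omega_{i,a}c_{i,a}$. *)

theory Defs
  imports "HOL-Analysis.Analysis" "HOL-Library.Poly_Mapping"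
begin

text \<open>
  A lattice M of rank n is embedded in a Euclidean space as the integer span of n linearly
  independent vectors. The space may be larger than span M, which plays the role of the real
  vector space of M; in particular n = 0 is allowed.
\<close>

definition lattice_of_rank :: "nat \<Rightarrow> 'a::euclidean_space set \<Rightarrow> bool" where
  "lattice_of_rank n M \<longleftrightarrow>
     (\<exists>B. independent B \<and> card B = n \<and>
          M = range (\<lambda>k::'a \<Rightarrow> int. \<Sum>b\<in>B. of_int (k b) *\<^sub>R b))"


text \<open>
  A function on a polytope P is a function on the whole space, considered only on P, and P is
  passed along explicitly. Restricting a function thus means passing a smaller polytope. Families
  indexed by 0, ..., n are functions on nat that are only used at i \<le> n.
\<close>

definition convex_piecewise_affine_on :: "'a::euclidean_space set \<Rightarrow> ('a \<Rightarrow> real) \<Rightarrow> bool" where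
  "convex_piecewise_affine_on P f \<longleftrightarrow>
     convex_on P f \<and>
     (\<exists>\<Q>. finite \<Q> \<and> \<Union>\<Q> = P \<and>
          (\<forall>Q\<in>\<Q>. polytope Q \<and> (\<exists>v c. \<forall>x\<in>Q. f x = v \<bullet> x + c)))"

definition defined_on_support :: "'a::euclidean_space set \<Rightarrow> ('a \<Rightarrow> real) \<Rightarrow> bool" where
  "defined_on_support A f \<longleftrightarrow>
     (\<exists>\<nu>::'a \<Rightarrow> real. \<forall>x\<in>convex hull A.
        (x, f x) \<in> convex hull ((\<lambda>a. (a, \<nu> a)) ` A) \<and>
        (\<forall>z. (x, z) \<in> convex hull ((\<lambda>a. (a, \<nu> a)) ` A) \<longrightarrow> f x \<le> z))"

text \<open>
  The elements of the dual space are represented by vectors v through the inner product. Vectors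
  with the same orthogonal projection to span M represent the same functional on span M, and
  hence define the same cell.
\<close>

definition cell :: "'a::euclidean_space set \<Rightarrow> ('a \<Rightarrow> real) \<Rightarrow> 'a \<Rightarrow> 'a set" where
  "cell P f v = {x \<in> P. \<forall>y\<in>P. f x + v \<bullet> x \<le> f y + v \<bullet> y}"

definition subdivision :: "'a::euclidean_space set \<Rightarrow> ('a \<Rightarrow> real) \<Rightarrow> 'a set set" where
  "subdivision P f = range (cell P f)"

definition inf_conv :: "nat \<Rightarrow> (nat \<Rightarrow> 'a::euclidean_space set) \<Rightarrow> (nat \<Rightarrow> 'a \<Rightarrow> real) \<Rightarrow> 'a \<Rightarrow> real" where
  "inf_conv n P \<rho> x =
     Inf {\<Sum>i\<le>n. \<rho> i (y i) | y. (\<forall>i\<le>n. y i \<in> P i) \<and> (\<Sum>i\<le>n. y i) = x}"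

text \<open>The sum of the sets P i is their Minkowski sum.\<close>

definition mixed_subdivision ::
  "nat \<Rightarrow> (nat \<Rightarrow> 'a::euclidean_space set) \<Rightarrow> (nat \<Rightarrow> 'a \<Rightarrow> real) \<Rightarrow> 'a set set" where
  "mixed_subdivision n P \<rho> = subdivision (\<Sum>i\<le>n. P i) (inf_conv n P \<rho>)"

definition top_cells ::
  "nat \<Rightarrow> (nat \<Rightarrow> 'a::euclidean_space set) \<Rightarrow> (nat \<Rightarrow> 'a \<Rightarrow> real) \<Rightarrow> 'a set set" where
  "top_cells n P \<rho> = {C \<in> mixed_subdivision n P \<rho>. aff_dim C = int n}"

definition component ::
  "nat \<Rightarrow> (nat \<Rightarrow> 'a::euclidean_space set) \<Rightarrow> (nat \<Rightarrow> 'a \<Rightarrow> real) \<Rightarrow> 'a set \<Rightarrow> nat \<Rightarrow> 'a set" where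
  "component n P \<rho> C i =
     {x i | x. (\<forall>j\<le>n. x j \<in> P j) \<and> (\<Sum>j\<le>n. x j) \<in> C \<and>
               inf_conv n P \<rho> (\<Sum>j\<le>n. x j) = (\<Sum>j\<le>n. \<rho> j (x j))}"

definition tight_mixed ::
  "nat \<Rightarrow> (nat \<Rightarrow> 'a::euclidean_space set) \<Rightarrow> (nat \<Rightarrow> 'a \<Rightarrow> real) \<Rightarrow> bool" where
  "tight_mixed n P \<rho> \<longleftrightarrow>
     (\<forall>C\<in>top_cells n P \<rho>. (\<Sum>i\<le>n. aff_dim (component n P \<rho> C i)) = int n)"

definition coarser ::
  "nat \<Rightarrow> (nat \<Rightarrow> 'a::euclidean_space set) \<Rightarrow> (nat \<Rightarrow> 'a \<Rightarrow> real) \<Rightarrow> (nat \<Rightarrow> 'a \<Rightarrow> real) \<Rightarrow> bool" where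
  "coarser n P \<phi> \<rho> \<longleftrightarrow>
     (\<forall>C\<in>mixed_subdivision n P \<rho>. \<exists>D\<in>mixed_subdivision n P \<phi>.
        C \<subseteq> D \<and> (\<forall>i\<le>n. component n P \<rho> C i \<subseteq> component n P \<phi> D i))"

definition generic_shift ::
  "nat \<Rightarrow> 'a::euclidean_space set \<Rightarrow> (nat \<Rightarrow> 'a set) \<Rightarrow> (nat \<Rightarrow> 'a \<Rightarrow> real) \<Rightarrow> 'a \<Rightarrow> bool" where
  "generic_shift n M P \<rho> \<delta> \<longleftrightarrow>
     (+) \<delta> ` \<Union>{C \<in> mixed_subdivision n P \<rho>. aff_dim C \<le> int n - 1} \<inter> M = {}"


text \<open>
  Polynomials with complex coefficients in the variables u(i,a); a monomial is the finitely
  supported function giving its exponents.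
\<close>

type_synonym 'a cpoly = "((nat \<times> 'a) \<Rightarrow>\<^sub>0 nat) \<Rightarrow>\<^sub>0 complex"

definition u_var :: "nat \<Rightarrow> 'a \<Rightarrow> 'a cpoly" where
  "u_var i a = Poly_Mapping.single (Poly_Mapping.single (i, a) 1) 1"

definition weight :: "(nat \<times> 'a \<Rightarrow> real) \<Rightarrow> ((nat \<times> 'a) \<Rightarrow>\<^sub>0 nat) \<Rightarrow> real" where
  "weight \<omega> c = (\<Sum>x\<in>Poly_Mapping.keys c. \<omega> x * real (Poly_Mapping.lookup c x))"

text \<open>The initial part of a nonzero polynomial; the initial part of 0 is 0 here.\<close>

definition init_part :: "(nat \<times> 'a \<Rightarrow> real) \<Rightarrow> 'a cpoly \<Rightarrow> 'a cpoly" where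
  "init_part \<omega> p =
     (\<Sum>c | c \<in> Poly_Mapping.keys p \<and> (\<forall>c'\<in>Poly_Mapping.keys p. weight \<omega> c \<le> weight \<omega> c').
        Poly_Mapping.single c (Poly_Mapping.lookup p c))"

text \<open>
  The Leibniz formula by which \<^const>\<open>det\<close> is defined, for a matrix indexed by a finite set instead of
  a finite type. The determinant of the empty matrix is 1.
\<close>

definition det_on :: "'b set \<Rightarrow> ('b \<Rightarrow> 'b \<Rightarrow> 'r::comm_ring_1) \<Rightarrow> 'r" where
  "det_on B H = (\<Sum>p | p permutes B. of_int (sign p) * (\<Prod>b\<in>B. H b (p b)))"

lemma det_on_UNIV: "det_on UNIV (\<lambda>i j. X $ i $ j) = det X"
  by (simp add: det_on_def det_def)

lemma det_on_empty: "det_on {} H = 1"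
  by (simp add: det_on_def sign_id)


definition ce_index ::
  "nat \<Rightarrow> 'a::euclidean_space set \<Rightarrow> (nat \<Rightarrow> 'a set) \<Rightarrow> 'a \<Rightarrow> 'a set" where
  "ce_index n M P \<delta> = (+) \<delta> ` (\<Sum>i\<le>n. P i) \<inter> M"

definition ce_cell ::
  "nat \<Rightarrow> (nat \<Rightarrow> 'a::euclidean_space set) \<Rightarrow> (nat \<Rightarrow> 'a \<Rightarrow> real) \<Rightarrow> 'a \<Rightarrow> 'a \<Rightarrow> 'a set" where
  "ce_cell n P \<rho> \<delta> b = (THE C. C \<in> top_cells n P \<rho> \<and> b \<in> (+) \<delta> ` C)"

definition ce_row ::
  "nat \<Rightarrow> (nat \<Rightarrow> 'a::euclidean_space set) \<Rightarrow> (nat \<Rightarrow> 'a \<Rightarrow> real) \<Rightarrow> 'a \<Rightarrow> 'a \<Rightarrow> nat" where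
  "ce_row n P \<rho> \<delta> b =
     (GREATEST i. i \<le> n \<and> aff_dim (component n P \<rho> (ce_cell n P \<rho> \<delta> b) i) = 0)"

definition ce_point ::
  "nat \<Rightarrow> (nat \<Rightarrow> 'a::euclidean_space set) \<Rightarrow> (nat \<Rightarrow> 'a \<Rightarrow> real) \<Rightarrow> 'a \<Rightarrow> 'a \<Rightarrow> 'a" where
  "ce_point n P \<rho> \<delta> b =
     the_elem (component n P \<rho> (ce_cell n P \<rho> \<delta> b) (ce_row n P \<rho> \<delta> b))"

definition ce_matrix ::
  "nat \<Rightarrow> (nat \<Rightarrow> 'a::euclidean_space set) \<Rightarrow> (nat \<Rightarrow> 'a set) \<Rightarrow> (nat \<Rightarrow> 'a \<Rightarrow> real) \<Rightarrow> 'a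
     \<Rightarrow> 'a \<Rightarrow> 'a \<Rightarrow> 'a cpoly" where
  "ce_matrix n P A \<rho> \<delta> b b' =
     (let i = ce_row n P \<rho> \<delta> b; a = b' - b + ce_point n P \<rho> \<delta> b
      in if a \<in> A i then u_var i a else 0)"

text \<open>
  Here P is the family of the domains of the functions \<rho> i, with P i = conv (A i) for the
  original data and P i = D i (together with A i \<inter> D i) for the restriction to a cell D.
\<close>

definition ce_det ::
  "nat \<Rightarrow> 'a::euclidean_space set \<Rightarrow> (nat \<Rightarrow> 'a set) \<Rightarrow> (nat \<Rightarrow> 'a set) \<Rightarrow> (nat \<Rightarrow> 'a \<Rightarrow> real) \<Rightarrow> 'a
     \<Rightarrow> 'a cpoly" where
  "ce_det n M P A \<rho> \<delta> = det_on (ce_index n M P \<delta>) (ce_matrix n P A \<rho> \<delta>)"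

end

theory Submission
  imports Defs
begin

text \<open>
  Grade each variable \<open>u(i,a)\<close> by \<open>\<phi> i a\<close>. The inf-convolution \<open>\<Phi>\<close> of the \<open>\<phi> i\<close> is a potential for this
  grading. Let \<open>b\<close> be a row, with row index \<open>i\<close> and row point \<open>a\<close>. The point \<open>b - \<delta>\<close> is an optimal
  sum of \<open>a\<close> and of points \<open>y j\<close>, \<open>j \<noteq> i\<close>, also for the functions \<open>\<phi> j\<close>, because \<open>S(\<rho>)\<close> refines
  \<open>S(\<phi>)\<close> together with the components. A nonzero entry in column \<open>c\<close> is the variable of
  \<open>a' = c - b + a\<close>, and exchanging \<open>a\<close> for \<open>a'\<close> turns this sum into a sum for \<open>c - \<delta>\<close>, so

    \<open>\<phi> i a' \<ge> \<phi> i a + \<Phi> (c - \<delta>) - \<Phi> (b - \<delta>)\<close>.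

  Along a permutation the potentials cancel. Every monomial in the Leibniz expansion therefore has
  weight at least that of the product of the diagonal, and the terms of this weight are the ones
  all of whose entries attain equality: the part of this weight is the determinant of the matrix of
  the entries with equality (\<open>init_part_det_potential\<close>). It is the initial part as soon as it is
  nonzero. To see that the diagonal monomial does not cancel, apply the same inequality to \<open>\<rho>\<close> in
  place of \<open>\<phi>\<close>: there equality holds only on the diagonal.

  It remains to see that equality holds exactly when \<open>a'\<close> lies in the component \<open>D i\<close> of the cell
  \<open>D\<close> of \<open>S(\<phi>)\<close> that contains \<open>b - \<delta>\<close>, and that then \<open>c - \<delta>\<close> lies in \<open>D\<close> (\<open>potential\<close>). The
  matrix of these entries is then block diagonal, and its blocks are the Canny-Emiris matrices of the
  restrictions. If equality holds, the points \<open>y j\<close> and \<open>a'\<close> minimise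
  \<open>\<phi> j + w'\<close> for the slope \<open>w'\<close> of the cell of \<open>c - \<delta>\<close>, while the components \<open>C j\<close> of the cell of
  \<open>b - \<delta>\<close> in \<open>S(\<rho>)\<close> minimise \<open>\<phi> j + w\<close> for the slope \<open>w\<close> of \<open>D\<close>. Hence \<open>w' - w\<close> is smallest on \<open>C j\<close>
  at \<open>y j\<close> for \<open>j \<noteq> i\<close>, and trivially for \<open>j = i\<close>, where \<open>C i\<close> is a point. Genericity of \<open>\<delta>\<close> forces
  such a functional to vanish on the span of the lattice (\<open>generic_tilt_orthogonal\<close>): tilting the
  slope of the cell by a small multiple of it keeps all the \<open>y j\<close> minimal, so \<open>b - \<delta>\<close> also lies in
  a cell on which the functional is constant, and generic points lie only in cells of full
  dimension. So \<open>w\<close> and \<open>w'\<close> define the same cells. The same lemma shows that each shifted lattice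
  point lies in only one top-dimensional cell, of the original or of a restricted subdivision.

  That the \<open>\<rho> i\<close> are lower hulls of finitely many points makes small tilts harmless (\<open>tilt_cell\<close>)
  and ensures that the row point \<open>a\<close> belongs to the support, so that the diagonal entries are
  variables. Tightness provides the row index.
\<close>

section \<open>Determinants of matrices of variables\<close>

text \<open>
  A permutation whose term does not vanish maps \<open>B1\<close> into itself, so it is the composition of a
  permutation of \<open>B1\<close> and one of \<open>B2\<close>.
\<close>
lemma det_on_Un_block:
  fixes H :: "'b \<Rightarrow> 'b \<Rightarrow> 'r::comm_ring_1"
  assumes fin: "finite B1" "finite B2" and disj: "B1 \<inter> B2 = {}"
    and zero: "\<And>b c. b \<in> B1 \<Longrightarrow> c \<in> B2 \<Longrightarrow> H b c = 0"
  shows "det_on (B1 \<union> B2) H = det_on B1 H * det_on B2 H"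
proof -
  define P where "P = {p. p permutes B1} \<times> {q. q permutes B2}"
  define comp where "comp = (\<lambda>(p :: 'b \<Rightarrow> 'b, q :: 'b \<Rightarrow> 'b). p \<circ> q)"
  have on1: "(p \<circ> q) b = p b" if "q permutes B2" "b \<in> B1" for p q b
  proof -
    have "b \<notin> B2" using disj that by blast
    then show ?thesis using that permutes_not_in[of q B2 b] by simp
  qed
  have on2: "(p \<circ> q) b = q b" if "p permutes B1" "q permutes B2" "b \<in> B2" for p q b
  proof -
    have "q b \<notin> B1" using disj that permutes_in_image[of q B2 b] by blast
    then show ?thesis using that permutes_not_in[of p B1 "q b"] by simp
  qed
  have inj: "inj_on comp P"
  proof (rule inj_onI, clarsimp simp: P_def comp_def)
    fix p q p' q' assume p: "p permutes B1" "q permutes B2" "p' permutes B1" "q' permutes B2"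
      and eq: "p \<circ> q = p' \<circ> q'"
    have "p b = p' b" for b
      using on1 p eq permutes_not_in[of p B1 b] permutes_not_in[of p' B1 b] by metis
    moreover have "q b = q' b" for b
      using on2 p eq permutes_not_in[of q B2 b] permutes_not_in[of q' B2 b] by metis
    ultimately show "p = p' \<and> q = q'" by auto
  qed
  have sub: "comp ` P \<subseteq> {r. r permutes B1 \<union> B2}"
    by (auto simp: P_def comp_def intro!: permutes_compose intro: permutes_subset)
  have surj: "\<exists>b\<in>B1 \<union> B2. H b (r b) = 0" if r: "r permutes B1 \<union> B2" "r \<notin> comp ` P" for r
  proof (rule ccontr)
    assume "\<not> ?thesis"
    then have "r ` B1 \<subseteq> B1"
      using zero r(1) permutes_in_image[OF r(1)] by fastforce
    then have r1: "r ` B1 = B1"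
      using endo_inj_surj[OF fin(1)] permutes_inj_on[OF r(1)] by blast
    have "r ` (B1 \<union> B2 - B1) = r ` (B1 \<union> B2) - r ` B1"
      using permutes_inj_on[OF r(1), of UNIV] by (intro image_set_diff) auto
    moreover have "B1 \<union> B2 - B1 = B2" using disj by auto
    ultimately have r2: "r ` B2 = B2"
      using r1 permutes_image[OF r(1)] by auto
    have "bij_betw r B1 B1" "bij_betw r B2 B2"
      using r1 r2 permutes_inj_on[OF r(1)] by (auto simp: bij_betw_def)
    then have "restrict_id r B1 permutes B1" "restrict_id r B2 permutes B2"
      by (auto intro: permutes_restrict_id)
    moreover have "r = restrict_id r B1 \<circ> restrict_id r B2"
    proof
      fix b show "r b = (restrict_id r B1 \<circ> restrict_id r B2) b"
        using r2 disj permutes_not_in[OF r(1), of b] by (auto simp: restrict_id_def)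
    qed
    ultimately have "r \<in> comp ` P"
      by (intro image_eqI[of _ _ "(restrict_id r B1, restrict_id r B2)"]) (auto simp: P_def comp_def)
    then show False using r(2) by blast
  qed
  have "det_on (B1 \<union> B2) H =
      (\<Sum>r\<in>comp ` P. of_int (sign r) * (\<Prod>b\<in>B1 \<union> B2. H b (r b)))"
    unfolding det_on_def
  proof (rule sum.mono_neutral_right)
    show "\<forall>r\<in>{r. r permutes B1 \<union> B2} - comp ` P.
        of_int (sign r) * (\<Prod>b\<in>B1 \<union> B2. H b (r b)) = 0"
    proof
      fix r assume "r \<in> {r. r permutes B1 \<union> B2} - comp ` P"
      then obtain b where "b \<in> B1 \<union> B2" "H b (r b) = 0" using surj by auto
      then have "(\<Prod>b\<in>B1 \<union> B2. H b (r b)) = 0"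
        using fin by (intro prod_zero) auto
      then show "of_int (sign r) * (\<Prod>b\<in>B1 \<union> B2. H b (r b)) = 0" by simp
    qed
  qed (use sub fin in \<open>auto simp: finite_permutations\<close>)
  also have "\<dots> = (\<Sum>(p, q)\<in>P. (of_int (sign p) * (\<Prod>b\<in>B1. H b (p b))) *
                          (of_int (sign q) * (\<Prod>b\<in>B2. H b (q b))))"
    unfolding sum.reindex[OF inj]
  proof (rule sum.cong[OF refl], clarsimp simp: P_def comp_def)
    fix p q assume p: "p permutes B1" and q: "q permutes B2"
    have sign: "sign (p \<circ> q) = sign p * sign q"
      by (intro sign_compose permutation_permutes[THEN iffD2] exI[of _ B1] exI[of _ B2] conjI p q fin)
    have "(\<Prod>b\<in>B1 \<union> B2. H b ((p \<circ> q) b)) =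
        (\<Prod>b\<in>B1. H b ((p \<circ> q) b)) * (\<Prod>b\<in>B2. H b ((p \<circ> q) b))"
      using fin disj by (rule prod.union_disjoint)
    moreover have "(\<Prod>b\<in>B1. H b ((p \<circ> q) b)) = (\<Prod>b\<in>B1. H b (p b))"
      by (intro prod.cong refl arg_cong[where f = "H _"] on1[OF q])
    moreover have "(\<Prod>b\<in>B2. H b ((p \<circ> q) b)) = (\<Prod>b\<in>B2. H b (q b))"
      by (intro prod.cong refl arg_cong[where f = "H _"] on2[OF p q])
    ultimately have "(\<Prod>b\<in>B1 \<union> B2. H b (p (q b))) = (\<Prod>b\<in>B1. H b (p b)) * (\<Prod>b\<in>B2. H b (q b))"
      by (simp only: comp_apply)
    then show "of_int (sign (p \<circ> q)) * (\<Prod>b\<in>B1 \<union> B2. H b (p (q b))) =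
       of_int (sign p) * (\<Prod>b\<in>B1. H b (p b)) * (of_int (sign q) * (\<Prod>b\<in>B2. H b (q b)))"
      unfolding sign by simp
  qed
  also have "\<dots> = det_on B1 H * det_on B2 H"
    unfolding det_on_def sum_product P_def sum.cartesian_product by simp
  finally show ?thesis .
qed

lemma det_on_UN_block:
  fixes H :: "'b \<Rightarrow> 'b \<Rightarrow> 'r::comm_ring_1"
  assumes "finite T" "\<And>D. D \<in> T \<Longrightarrow> finite (B D)"
    and "\<And>D E. D \<in> T \<Longrightarrow> E \<in> T \<Longrightarrow> D \<noteq> E \<Longrightarrow> B D \<inter> B E = {}"
    and "\<And>D E b c. D \<in> T \<Longrightarrow> E \<in> T \<Longrightarrow> D \<noteq> E \<Longrightarrow> b \<in> B D \<Longrightarrow> c \<in> B E \<Longrightarrow> H b c = 0"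
  shows "det_on (\<Union>D\<in>T. B D) H = (\<Prod>D\<in>T. det_on (B D) H)"
  using assms
proof (induction T rule: finite_induct)
  case empty
  then show ?case by (simp add: det_on_empty)
next
  case (insert D T)
  have "det_on (B D \<union> (\<Union>E\<in>T. B E)) H = det_on (B D) H * det_on (\<Union>E\<in>T. B E) H"
  proof (rule det_on_Un_block)
    show "B D \<inter> (\<Union>E\<in>T. B E) = {}"
      using insert.prems(2)[of D] insert.hyps(2) by blast
    show "H b c = 0" if "b \<in> B D" "c \<in> (\<Union>E\<in>T. B E)" for b c
      using insert.prems(3)[of D] insert.hyps(2) that by blast
  qed (use insert in auto)
  moreover have "det_on (\<Union>E\<in>T. B E) H = (\<Prod>E\<in>T. det_on (B E) H)"
    by (intro insert.IH) (use insert.prems in blast)+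
  ultimately show ?case using insert.hyps by simp
qed

lemma det_on_cong:
  assumes "\<And>b c. b \<in> B \<Longrightarrow> c \<in> B \<Longrightarrow> H b c = K b c"
  shows "det_on B H = det_on B K"
  unfolding det_on_def
  by (intro sum.cong refl arg_cong2[of _ _ _ _ "(*)"] prod.cong)
     (auto simp: assms permutes_in_image)

definition monom_of :: "'b set \<Rightarrow> ('b \<Rightarrow> 'b \<Rightarrow> 'x) \<Rightarrow> ('b \<Rightarrow> 'b) \<Rightarrow> ('x \<Rightarrow>\<^sub>0 nat)" where
  "monom_of B k p = (\<Sum>b\<in>B. Poly_Mapping.single (k b (p b)) 1)"

definition var_matrix :: "('b \<Rightarrow> 'b \<Rightarrow> bool) \<Rightarrow> ('b \<Rightarrow> 'b \<Rightarrow> nat \<times> 'a) \<Rightarrow> 'b \<Rightarrow> 'b \<Rightarrow> 'a cpoly" where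
  "var_matrix E k b c = (if E b c then case_prod u_var (k b c) else 0)"

lemma prod_var_matrix:
  assumes "finite B"
  shows "(\<Prod>b\<in>B. var_matrix E k b (p b)) =
         (if \<forall>b\<in>B. E b (p b) then Poly_Mapping.single (monom_of B k p) 1 else 0)"
proof (cases "\<forall>b\<in>B. E b (p b)")
  case True
  then have "(\<Prod>b\<in>B. var_matrix E k b (p b)) =
      (\<Prod>b\<in>B. Poly_Mapping.single (Poly_Mapping.single (k b (p b)) 1) 1)"
    by (intro prod.cong) (auto simp: var_matrix_def u_var_def case_prod_beta)
  also have "\<dots> = Poly_Mapping.single (monom_of B k p) 1"
    unfolding monom_of_def using assms by (induction B rule: finite_induct) (auto simp: mult_single)
  finally show ?thesis using True by simp
next
  case False
  then show ?thesis using assms by (auto simp: var_matrix_def intro!: prod_zero)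
qed

lemma lookup_det_var_matrix:
  assumes "finite B"
  shows "Poly_Mapping.lookup (det_on B (var_matrix E k)) c =
    (\<Sum>p | p permutes B \<and> (\<forall>b\<in>B. E b (p b)) \<and> monom_of B k p = c. of_int (sign p))"
proof -
  have *: "of_int z * Poly_Mapping.single m 1 = (Poly_Mapping.single m (of_int z) :: 'c cpoly)"
    for z :: int and m :: "nat \<times> 'c \<Rightarrow>\<^sub>0 nat"
    using mult_single[of 0 "of_int z :: complex" m 1] by simp
  have "Poly_Mapping.lookup (det_on B (var_matrix E k)) c =
     (\<Sum>p | p permutes B. if (\<forall>b\<in>B. E b (p b)) \<and> monom_of B k p = c then of_int (sign p) else 0)"
    unfolding det_on_def lookup_sum
    by (intro sum.cong) (auto simp: prod_var_matrix[OF assms] * lookup_single when_def)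
  also have "\<dots> = (\<Sum>p\<in>{p. p permutes B} \<inter> {p. (\<forall>b\<in>B. E b (p b)) \<and> monom_of B k p = c}.
                    of_int (sign p))"
    using sum.inter_restrict[of "{p. p permutes B}" "\<lambda>p. of_int (sign p) :: complex"
        "{p. (\<forall>b\<in>B. E b (p b)) \<and> monom_of B k p = c}"] assms
    by (simp add: finite_permutations)
  finally show ?thesis by (simp add: Int_def conj_assoc)
qed

lemma weight_add: "weight \<omega> (c + d) = weight \<omega> c + weight \<omega> d"
proof -
  have w: "weight \<omega> e = (\<Sum>x\<in>K. \<omega> x * real (Poly_Mapping.lookup e x))"
    if "finite K" "Poly_Mapping.keys e \<subseteq> K" for e K
    unfolding weight_def using that by (intro sum.mono_neutral_left) (auto simp: in_keys_iff)
  show ?thesis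
    by (simp add: w[of "Poly_Mapping.keys c \<union> Poly_Mapping.keys d"] Poly_Mapping.keys_add lookup_add
        sum.distrib distrib_left)
qed

lemma weight_monom_of: "finite B \<Longrightarrow> weight \<omega> (monom_of B k p) = (\<Sum>b\<in>B. \<omega> (k b (p b)))"
proof (induction B rule: finite_induct)
  case empty
  then show ?case by (simp add: monom_of_def weight_def)
next
  case (insert b B)
  have "weight \<omega> (Poly_Mapping.single x 1) = \<omega> x" for x
    by (simp add: weight_def)
  then show ?case using insert by (simp add: monom_of_def weight_add)
qed

text \<open>
  The potentials \<open>h\<close> cancel along a permutation, since \<open>p b\<close> runs through \<open>B\<close> when \<open>b\<close> does.
\<close>
lemma weight_ge_of_potential:
  assumes fin: "finite B" and p: "p permutes B"
    and ge: "\<And>b. b \<in> B \<Longrightarrow> \<omega> (k b (p b)) \<ge> r b + h (p b) - h b"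
  shows "weight \<omega> (monom_of B k p) \<ge> (\<Sum>b\<in>B. r b)"
    and "weight \<omega> (monom_of B k p) = (\<Sum>b\<in>B. r b) \<longleftrightarrow>
           (\<forall>b\<in>B. \<omega> (k b (p b)) = r b + h (p b) - h b)"
proof -
  have "(\<Sum>b\<in>B. h (p b)) = (\<Sum>b\<in>B. h b)"
    using sum.permute[OF p, of h] by (simp add: o_def)
  then have r: "(\<Sum>b\<in>B. r b) = (\<Sum>b\<in>B. r b + h (p b) - h b)"
    by (simp add: sum.distrib sum_subtractf)
  show "weight \<omega> (monom_of B k p) \<ge> (\<Sum>b\<in>B. r b)"
    unfolding r weight_monom_of[OF fin] by (intro sum_mono ge)
  show "weight \<omega> (monom_of B k p) = (\<Sum>b\<in>B. r b) \<longleftrightarrow>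
           (\<forall>b\<in>B. \<omega> (k b (p b)) = r b + h (p b) - h b)"
    unfolding r weight_monom_of[OF fin]
  proof
    assume eq: "(\<Sum>b\<in>B. \<omega> (k b (p b))) = (\<Sum>b\<in>B. r b + h (p b) - h b)"
    show "\<forall>b\<in>B. \<omega> (k b (p b)) = r b + h (p b) - h b"
      using sum_mono_inv[OF eq[symmetric] ge _ fin] by auto
  qed simp
qed

text \<open>
  By the potential \<open>h\<close> the terms of least possible weight are those with equality in every entry. They
  need not survive in the sum; the second grading \<open>\<omega>'\<close>, for which equality holds only on
  the diagonal, singles out the diagonal monomial as one that comes from the identity alone.
\<close>
lemma init_part_det_potential:
  fixes k :: "'b \<Rightarrow> 'b \<Rightarrow> nat \<times> 'a" and \<omega> \<omega>' :: "nat \<times> 'a \<Rightarrow> real"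
  assumes fin: "finite B"
    and ge: "\<And>b c. b \<in> B \<Longrightarrow> c \<in> B \<Longrightarrow> E b c \<Longrightarrow> \<omega> (k b c) \<ge> r b + h c - h b"
    and ge': "\<And>b c. b \<in> B \<Longrightarrow> c \<in> B \<Longrightarrow> E b c \<Longrightarrow> \<omega>' (k b c) \<ge> r' b + h' c - h' b"
    and eq': "\<And>b c. b \<in> B \<Longrightarrow> c \<in> B \<Longrightarrow> E b c \<Longrightarrow> \<omega>' (k b c) = r' b + h' c - h' b \<Longrightarrow> c = b"
    and diag: "\<And>b. b \<in> B \<Longrightarrow> E b b \<and> \<omega> (k b b) = r b \<and> \<omega>' (k b b) = r' b"
  shows "init_part \<omega> (det_on B (var_matrix E k)) =
         det_on B (var_matrix (\<lambda>b c. E b c \<and> \<omega> (k b c) = r b + h c - h b) k)"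
    (is "_ = det_on B (var_matrix ?G k)")
proof -
  let ?V = "\<lambda>p. p permutes B \<and> (\<forall>b\<in>B. E b (p b))"
  let ?W = "\<Sum>b\<in>B. r b"
  let ?P = "det_on B (var_matrix E k)"
  have inB: "p b \<in> B" if "p permutes B" "b \<in> B" for p b
    using that by (simp add: permutes_in_image)
  have W: "weight \<omega> (monom_of B k p) \<ge> ?W"
    "weight \<omega> (monom_of B k p) = ?W \<longleftrightarrow> (\<forall>b\<in>B. ?G b (p b))" if "?V p" for p
    using weight_ge_of_potential[of B p r h \<omega> k] fin that ge inB by auto
  have lookG: "Poly_Mapping.lookup (det_on B (var_matrix ?G k)) c =
      (if weight \<omega> c = ?W then Poly_Mapping.lookup ?P c else 0)" for c
  proof -
    have "{p. p permutes B \<and> (\<forall>b\<in>B. ?G b (p b)) \<and> monom_of B k p = c} =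
      (if weight \<omega> c = ?W then {p. p permutes B \<and> (\<forall>b\<in>B. E b (p b)) \<and> monom_of B k p = c} else {})"
      using W(2) by auto
    then show ?thesis unfolding lookup_det_var_matrix[OF fin] by simp
  qed
  have keysW: "weight \<omega> c \<ge> ?W" if "c \<in> Poly_Mapping.keys ?P" for c
  proof -
    have "{p. p permutes B \<and> (\<forall>b\<in>B. E b (p b)) \<and> monom_of B k p = c} \<noteq> {}"
      using that unfolding in_keys_iff lookup_det_var_matrix[OF fin] by (metis sum.empty)
    then show ?thesis using W(1) by auto
  qed
  let ?d = "monom_of B k id"
  \<comment> \<open>only the identity has the monomial of the diagonal, by the second grading\<close>
  have diag_key: "?d \<in> Poly_Mapping.keys ?P" "weight \<omega> ?d = ?W"
  proof -
    have "p = id" if V: "?V p" and eq: "monom_of B k p = ?d" for p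
    proof -
      have "weight \<omega>' (monom_of B k p) = (\<Sum>b\<in>B. r' b)"
        unfolding eq using diag by (simp add: weight_monom_of[OF fin])
      then have "\<forall>b\<in>B. \<omega>' (k b (p b)) = r' b + h' (p b) - h' b"
        using weight_ge_of_potential(2)[of B p r' h' \<omega>' k] fin V ge' inB by auto
      then have "p b = b" if "b \<in> B" for b using eq'[of b "p b"] V inB that by auto
      then show "p = id" using V permutes_not_in[of p B] by fastforce
    qed
    moreover have "?V id" using diag by (auto simp: permutes_id)
    ultimately have "{p. p permutes B \<and> (\<forall>b\<in>B. E b (p b)) \<and> monom_of B k p = ?d} = {id}"
      by auto
    then show "?d \<in> Poly_Mapping.keys ?P"
      by (simp add: in_keys_iff lookup_det_var_matrix[OF fin])
    show "weight \<omega> ?d = ?W" using diag by (simp add: weight_monom_of[OF fin])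
  qed
  have min_iff: "(\<forall>c'\<in>Poly_Mapping.keys ?P. weight \<omega> c \<le> weight \<omega> c') \<longleftrightarrow> weight \<omega> c = ?W"
    if "c \<in> Poly_Mapping.keys ?P" for c
    using keysW diag_key that by (metis order_antisym)
  show ?thesis
  proof (rule poly_mapping_eqI)
    fix c
    let ?K = "{c \<in> Poly_Mapping.keys ?P. \<forall>c'\<in>Poly_Mapping.keys ?P. weight \<omega> c \<le> weight \<omega> c'}"
    have "Poly_Mapping.lookup (init_part \<omega> ?P) c =
        (\<Sum>d\<in>?K. if d = c then Poly_Mapping.lookup ?P c else 0)"
      unfolding init_part_def lookup_sum by (intro sum.cong) (auto simp: lookup_single when_def)
    also have "\<dots> = (if c \<in> ?K then Poly_Mapping.lookup ?P c else 0)"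
      by (simp add: sum.delta)
    also have "\<dots> = Poly_Mapping.lookup (det_on B (var_matrix ?G k)) c"
      unfolding lookG using min_iff[of c]
      by (cases "c \<in> Poly_Mapping.keys ?P") (simp_all add: not_in_keys_iff_lookup_eq_zero)
    finally show "Poly_Mapping.lookup (init_part \<omega> ?P) c =
      Poly_Mapping.lookup (det_on B (var_matrix ?G k)) c" .
  qed
qed

section \<open>Cells of an inf-convolution\<close>

lemma mem_sum_sets_iff:
  fixes P :: "nat \<Rightarrow> 'a::comm_monoid_add set"
  shows "x \<in> (\<Sum>i\<le>n. P i) \<longleftrightarrow> (\<exists>y. (\<forall>i\<le>n. y i \<in> P i) \<and> (\<Sum>i\<le>n. y i) = x)"
  by (auto simp: set_sum_alt)

lemma sum_fun_upd:
  fixes g :: "nat \<Rightarrow> 'a \<Rightarrow> 'b::ab_group_add"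
  assumes "i \<le> n"
  shows "(\<Sum>j\<le>n. g j ((y(i := z)) j)) = (\<Sum>j\<le>n. g j (y j)) - g i (y i) + g i z"
proof -
  have "(\<Sum>j\<in>{..n} - {i}. g j ((y(i := z)) j)) = (\<Sum>j\<in>{..n} - {i}. g j (y j))"
    by (intro sum.cong) auto
  then show ?thesis
    using assms by (simp add: sum.remove[of "{..n}" i "\<lambda>j. g j ((y(i := z)) j)"]
        sum.remove[of "{..n}" i "\<lambda>j. g j (y j)"] del: fun_upd_apply) simp
qed

lemma sum_sets_mono:
  fixes P Q :: "nat \<Rightarrow> 'a::comm_monoid_add set"
  assumes "\<And>i. i \<le> n \<Longrightarrow> P i \<subseteq> Q i"
  shows "(\<Sum>i\<le>n. P i) \<subseteq> (\<Sum>i\<le>n. Q i)"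
proof
  fix x assume "x \<in> (\<Sum>i\<le>n. P i)"
  then obtain y where "\<forall>i\<le>n. y i \<in> P i" "(\<Sum>i\<le>n. y i) = x" unfolding mem_sum_sets_iff by blast
  then show "x \<in> (\<Sum>i\<le>n. Q i)"
    unfolding mem_sum_sets_iff using assms by (intro exI[of _ y]) auto
qed

lemma cell_subset: "cell P f v \<subseteq> P"
  by (auto simp: cell_def)

lemma cell_restrict:
  assumes "cell P f v \<subseteq> Q" "Q \<subseteq> P" "cell P f v \<noteq> {}"
  shows "cell Q f v = cell P f v"
proof -
  obtain x where x: "x \<in> cell P f v" using assms(3) by blast
  show ?thesis
  proof
    show "cell Q f v \<subseteq> cell P f v"
    proof
      fix z assume "z \<in> cell Q f v"
      then have "z \<in> P" "f z + v \<bullet> z \<le> f x + v \<bullet> x" using assms x by (auto simp: cell_def)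
      then show "z \<in> cell P f v" using x unfolding cell_def by fastforce
    qed
  qed (use assms in \<open>auto simp: cell_def\<close>)
qed

lemma tilt_minimal:
  assumes "y \<in> cell P f w'" "y \<in> cell P f w" "c \<in> cell P f w"
  shows "(w' - w) \<bullet> y \<le> (w' - w) \<bullet> c"
proof -
  have "f y + w' \<bullet> y \<le> f c + w' \<bullet> c" "f c + w \<bullet> c \<le> f y + w \<bullet> y"
    using assms by (auto simp: cell_def)
  then show ?thesis by (simp add: inner_diff_left)
qed

text \<open>
  The lower bounds rule out an infimum over a set that is unbounded below, which would be an
  unspecified value. They may hold after adding a common functional, since that changes all sums for
  the same point by the same amount.
\<close>
lemma inf_conv_le:
  assumes "\<And>i z. i \<le> n \<Longrightarrow> z \<in> P i \<Longrightarrow> m i \<le> f i z + v \<bullet> z"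
    and z: "\<And>i. i \<le> n \<Longrightarrow> z i \<in> P i"
  shows "inf_conv n P f (\<Sum>i\<le>n. z i) \<le> (\<Sum>i\<le>n. f i (z i))"
  unfolding inf_conv_def
proof (rule cInf_lower)
  show "bdd_below {\<Sum>i\<le>n. f i (y i) |y. (\<forall>i\<le>n. y i \<in> P i) \<and> (\<Sum>i\<le>n. y i) = (\<Sum>i\<le>n. z i)}"
  proof (rule bdd_belowI[of _ "(\<Sum>i\<le>n. m i) - v \<bullet> (\<Sum>i\<le>n. z i)"], clarify)
    fix y assume y: "\<forall>i\<le>n. y i \<in> P i" "(\<Sum>i\<le>n. y i) = (\<Sum>i\<le>n. z i)"
    have "(\<Sum>i\<le>n. m i) \<le> (\<Sum>i\<le>n. f i (y i) + v \<bullet> y i)"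
      using assms(1) y(1) by (intro sum_mono) auto
    then show "(\<Sum>i\<le>n. m i) - v \<bullet> (\<Sum>i\<le>n. z i) \<le> (\<Sum>i\<le>n. f i (y i))"
      unfolding y(2)[symmetric] by (simp add: sum.distrib inner_sum_right)
  qed
qed (use z in auto)

lemma inf_conv_eq_of_mem_cells:
  assumes "\<And>i. i \<le> n \<Longrightarrow> y i \<in> cell (P i) (f i) v"
  shows "inf_conv n P f (\<Sum>i\<le>n. y i) = (\<Sum>i\<le>n. f i (y i))"
  unfolding inf_conv_def
proof (rule cInf_eq_minimum)
  show "(\<Sum>i\<le>n. f i (y i)) \<in> {\<Sum>i\<le>n. f i (z i) |z. (\<forall>i\<le>n. z i \<in> P i) \<and> (\<Sum>i\<le>n. z i) = (\<Sum>i\<le>n. y i)}"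
    using assms cell_subset by blast
next
  fix t assume "t \<in> {\<Sum>i\<le>n. f i (z i) |z. (\<forall>i\<le>n. z i \<in> P i) \<and> (\<Sum>i\<le>n. z i) = (\<Sum>i\<le>n. y i)}"
  then obtain z where z: "\<forall>i\<le>n. z i \<in> P i" "(\<Sum>i\<le>n. z i) = (\<Sum>i\<le>n. y i)" "t = (\<Sum>i\<le>n. f i (z i))"
    by auto
  have "(\<Sum>i\<le>n. f i (y i) + v \<bullet> y i) \<le> (\<Sum>i\<le>n. f i (z i) + v \<bullet> z i)"
    using assms z(1) by (intro sum_mono) (auto simp: cell_def)
  then show "(\<Sum>i\<le>n. f i (y i)) \<le> t"
    using z by (simp add: sum.distrib flip: inner_sum_right)
qed

lemma sum_mem_cell:
  assumes "\<And>i. i \<le> n \<Longrightarrow> y i \<in> cell (P i) (f i) v"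
  shows "(\<Sum>i\<le>n. y i) \<in> cell (\<Sum>i\<le>n. P i) (inf_conv n P f) v"
proof -
  have "inf_conv n P f (\<Sum>i\<le>n. y i) + v \<bullet> (\<Sum>i\<le>n. y i) \<le> inf_conv n P f x + v \<bullet> x"
    if "x \<in> (\<Sum>i\<le>n. P i)" for x
  proof -
    have "(\<Sum>i\<le>n. f i (y i)) + v \<bullet> (\<Sum>i\<le>n. y i) - v \<bullet> x \<le> inf_conv n P f x"
      unfolding inf_conv_def[of n P f x]
    proof (rule cInf_greatest)
      show "{\<Sum>i\<le>n. f i (y i) |y. (\<forall>i\<le>n. y i \<in> P i) \<and> (\<Sum>i\<le>n. y i) = x} \<noteq> {}"
        using that by (auto simp: mem_sum_sets_iff)
    next
      fix t assume "t \<in> {\<Sum>i\<le>n. f i (y i) |y. (\<forall>i\<le>n. y i \<in> P i) \<and> (\<Sum>i\<le>n. y i) = x}"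
      then obtain z where z: "\<forall>i\<le>n. z i \<in> P i" "(\<Sum>i\<le>n. z i) = x" "t = (\<Sum>i\<le>n. f i (z i))"
        by auto
      have "(\<Sum>i\<le>n. f i (y i) + v \<bullet> y i) \<le> (\<Sum>i\<le>n. f i (z i) + v \<bullet> z i)"
        using assms z(1) by (intro sum_mono) (auto simp: cell_def)
      then show "(\<Sum>i\<le>n. f i (y i)) + v \<bullet> (\<Sum>i\<le>n. y i) - v \<bullet> x \<le> t"
        unfolding z(2)[symmetric] z(3) by (simp add: sum.distrib inner_sum_right)
    qed
    then show ?thesis using inf_conv_eq_of_mem_cells[of n y P f v] assms by simp
  qed
  moreover have "(\<Sum>i\<le>n. y i) \<in> (\<Sum>i\<le>n. P i)"
    unfolding mem_sum_sets_iff using assms cell_subset by blast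
  ultimately show ?thesis unfolding cell_def by auto
qed

text \<open>
  Replacing one summand by another point of the same \<open>P i\<close> changes the sum of the \<open>f i\<close> and the
  functional in a single place, so each summand is minimal on its own.
\<close>
lemma summands_mem_cells:
  assumes low: "\<And>i z. i \<le> n \<Longrightarrow> z \<in> P i \<Longrightarrow> m i \<le> f i z + v \<bullet> z"
    and y: "\<And>i. i \<le> n \<Longrightarrow> y i \<in> P i"
    and att: "inf_conv n P f (\<Sum>i\<le>n. y i) = (\<Sum>i\<le>n. f i (y i))"
    and mem: "(\<Sum>i\<le>n. y i) \<in> cell (\<Sum>i\<le>n. P i) (inf_conv n P f) w"
    and i: "i \<le> n"
  shows "y i \<in> cell (P i) (f i) w"
proof -
  have "f i (y i) + w \<bullet> y i \<le> f i z + w \<bullet> z" if z: "z \<in> P i" for z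
  proof -
    let ?y = "y(i := z)"
    have y': "\<And>j. j \<le> n \<Longrightarrow> ?y j \<in> P j" using y z by auto
    then have "(\<Sum>j\<le>n. ?y j) \<in> (\<Sum>j\<le>n. P j)" unfolding mem_sum_sets_iff by blast
    then have "inf_conv n P f (\<Sum>j\<le>n. y j) + w \<bullet> (\<Sum>j\<le>n. y j)
        \<le> inf_conv n P f (\<Sum>j\<le>n. ?y j) + w \<bullet> (\<Sum>j\<le>n. ?y j)"
      using mem by (auto simp: cell_def)
    also have "inf_conv n P f (\<Sum>j\<le>n. ?y j) \<le> (\<Sum>j\<le>n. f j (?y j))"
      using inf_conv_le[of n P m f v ?y] low y' by blast
    finally show ?thesis
      unfolding att sum_fun_upd[OF i, of f] sum_fun_upd[OF i, of "\<lambda>j x. x"] by (simp add: inner_add_right inner_diff_right)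
  qed
  then show ?thesis using y[OF i] by (simp add: cell_def)
qed

lemma component_eq_cell:
  assumes y: "\<And>i. i \<le> n \<Longrightarrow> y i \<in> cell (P i) (f i) v" and i: "i \<le> n"
  shows "component n P f (cell (\<Sum>i\<le>n. P i) (inf_conv n P f) v) i = cell (P i) (f i) v"
proof
  have low: "f j (y j) + v \<bullet> y j \<le> f j z + v \<bullet> z" if "j \<le> n" "z \<in> P j" for j z
    using y that by (auto simp: cell_def)
  show "component n P f (cell (\<Sum>i\<le>n. P i) (inf_conv n P f) v) i \<subseteq> cell (P i) (f i) v"
    using summands_mem_cells[of n P "\<lambda>j. f j (y j) + v \<bullet> y j" f v _ v i, OF low] i
    by (auto simp: component_def)
next
  show "cell (P i) (f i) v \<subseteq> component n P f (cell (\<Sum>i\<le>n. P i) (inf_conv n P f) v) i"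
  proof
    fix z assume z: "z \<in> cell (P i) (f i) v"
    have y': "\<And>j. j \<le> n \<Longrightarrow> (y(i := z)) j \<in> cell (P j) (f j) v" using y z by auto
    have "(y(i := z)) i \<in> component n P f (cell (\<Sum>i\<le>n. P i) (inf_conv n P f) v) i"
      unfolding component_def
      using sum_mem_cell[of n "y(i := z)", OF y'] inf_conv_eq_of_mem_cells[of n "y(i := z)", OF y']
        y' cell_subset by blast
    then show "z \<in> component n P f (cell (\<Sum>i\<le>n. P i) (inf_conv n P f) v) i" by simp
  qed
qed

text \<open>
  Every point of the sum is a sum of points that are minimal for a common slope. This says both that
  the cells cover the sum and that the infimum in the inf-convolution is attained.
\<close>
definition exact_sum :: "nat \<Rightarrow> (nat \<Rightarrow> 'a::euclidean_space set) \<Rightarrow> (nat \<Rightarrow> 'a \<Rightarrow> real) \<Rightarrow> bool" where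
  "exact_sum n P f \<longleftrightarrow>
     (\<forall>x\<in>\<Sum>i\<le>n. P i. \<exists>v y. (\<forall>i\<le>n. y i \<in> cell (P i) (f i) v) \<and> (\<Sum>i\<le>n. y i) = x)"

lemma cell_eq_sum_cells:
  assumes "exact_sum n P f"
  shows "cell (\<Sum>i\<le>n. P i) (inf_conv n P f) w = (\<Sum>i\<le>n. cell (P i) (f i) w)"
proof
  show "cell (\<Sum>i\<le>n. P i) (inf_conv n P f) w \<subseteq> (\<Sum>i\<le>n. cell (P i) (f i) w)"
  proof
    fix x assume x: "x \<in> cell (\<Sum>i\<le>n. P i) (inf_conv n P f) w"
    then have "x \<in> (\<Sum>i\<le>n. P i)" using cell_subset by blast
    then obtain v y where y: "\<forall>i\<le>n. y i \<in> cell (P i) (f i) v" "(\<Sum>i\<le>n. y i) = x"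
      using assms unfolding exact_sum_def by blast
    have "y i \<in> cell (P i) (f i) w" if "i \<le> n" for i
    proof (rule summands_mem_cells[where m = "\<lambda>j. f j (y j) + v \<bullet> y j" and v = v and y = y])
      show "inf_conv n P f (\<Sum>i\<le>n. y i) = (\<Sum>i\<le>n. f i (y i))"
        using y by (intro inf_conv_eq_of_mem_cells[where v = v]) auto
    qed (use y x that in \<open>auto simp: cell_def\<close>)
    then show "x \<in> (\<Sum>i\<le>n. cell (P i) (f i) w)"
      unfolding mem_sum_sets_iff using y(2) by blast
  qed
next
  show "(\<Sum>i\<le>n. cell (P i) (f i) w) \<subseteq> cell (\<Sum>i\<le>n. P i) (inf_conv n P f) w"
  proof
    fix x assume "x \<in> (\<Sum>i\<le>n. cell (P i) (f i) w)"
    then obtain y where y: "\<forall>i\<le>n. y i \<in> cell (P i) (f i) w" "(\<Sum>i\<le>n. y i) = x"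
      unfolding mem_sum_sets_iff by blast
    show "x \<in> cell (\<Sum>i\<le>n. P i) (inf_conv n P f) w"
      unfolding y(2)[symmetric] by (rule sum_mem_cell) (use y in auto)
  qed
qed

section \<open>Lower hulls of finitely many points\<close>

lemma polytope_sum_convex_hulls:
  fixes S :: "nat \<Rightarrow> 'a::euclidean_space set"
  assumes "\<And>i. i \<le> n \<Longrightarrow> finite (S i)"
  shows "polytope (\<Sum>i\<le>n. convex hull (S i))"
proof -
  have "(\<Sum>i\<le>n. convex hull (S i)) = convex hull (\<Sum>i\<le>n. S i)"
    by (simp add: convex_hull_set_sum)
  moreover have "finite (\<Sum>i\<le>n. S i)"
    using assms by (induction n) (auto simp: finite_set_plus)
  ultimately show ?thesis by (simp add: polytope_convex_hull)
qed

text \<open>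
  Just below \<open>(x, z)\<close> one of the finitely many halfspaces that cut out \<open>Q\<close> is violated, arbitrarily
  close to \<open>(x, z)\<close>. Its boundary passes through \<open>(x, z)\<close> and is not vertical. This gives a
  subgradient also at boundary points of the domain, where convexity would not suffice.
\<close>
lemma polyhedron_lower_support:
  fixes Q :: "('a::euclidean_space \<times> real) set"
  assumes Q: "polyhedron Q" and mem: "(x, z) \<in> Q" and low: "\<And>t. (x, t) \<in> Q \<Longrightarrow> z \<le> t"
  obtains v where "\<And>y t. (y, t) \<in> Q \<Longrightarrow> z + v \<bullet> x \<le> t + v \<bullet> y"
proof -
  obtain F where F: "finite F" "Q = \<Inter>F" "\<forall>h\<in>F. \<exists>a b. a \<noteq> 0 \<and> h = {x. a \<bullet> x \<le> b}"
    using Q unfolding polyhedron_def by auto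
  have "\<exists>h\<in>F. \<exists>\<^sub>F e in at_right 0. (x, z - e) \<notin> h"
  proof (rule ccontr)
    assume "\<not> ?thesis"
    then have "\<forall>h\<in>F. \<forall>\<^sub>F e in at_right 0. (x, z - e) \<in> h" by (simp add: not_frequently)
    then have "\<forall>\<^sub>F e in at_right (0::real). \<forall>h\<in>F. (x, z - e) \<in> h"
      using F(1) by (simp add: eventually_ball_finite_distrib)
    moreover have "\<forall>\<^sub>F e in at_right (0::real). e > 0" by (simp add: eventually_at_right_less)
    ultimately have "\<forall>\<^sub>F e in at_right (0::real). e > 0 \<and> (x, z - e) \<in> Q"
      unfolding F(2) by eventually_elim auto
    then obtain e where "e > 0" "(x, z - e) \<in> Q"
      using eventually_happens'[OF trivial_limit_at_right_real] by blast
    then show False using low[of "z - e"] by simp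
  qed
  then obtain h where h: "h \<in> F" "\<exists>\<^sub>F e in at_right 0. (x, z - e) \<notin> h" by blast
  then obtain a c b where abc: "h = {p. (a, c) \<bullet> p \<le> b}" using F(3) by (metis surj_pair)
  have le: "a \<bullet> y + c * t \<le> b" if "(y, t) \<in> Q" for y t
    using that h(1) F(2) abc by (auto simp: inner_prod_def)
  have freq: "\<exists>\<^sub>F e in at_right 0. a \<bullet> x + c * z - c * e > b"
    using h(2) unfolding abc by (simp add: inner_prod_def not_le algebra_simps)
  have eq: "a \<bullet> x + c * z = b"
  proof (rule ccontr)
    assume "\<not> ?thesis"
    then have "a \<bullet> x + c * z < b" using le[OF mem] by simp
    moreover have "((\<lambda>e. a \<bullet> x + c * z - c * e) \<longlongrightarrow> a \<bullet> x + c * z - c * 0) (at_right 0)"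
      by (intro tendsto_intros)
    ultimately have "\<forall>\<^sub>F e in at_right 0. a \<bullet> x + c * z - c * e < b"
      using order_tendstoD(2) by fastforce
    with freq have "\<exists>\<^sub>F e in at_right (0::real). False"
      by (rule frequently_rev_mp[OF _ eventually_mono]) auto
    then show False by simp
  qed
  have "c < 0"
  proof (rule ccontr)
    assume "\<not> ?thesis"
    then have "\<forall>\<^sub>F e in at_right (0::real). \<not> a \<bullet> x + c * z - c * e > b"
      unfolding eq by (intro eventually_mono[OF eventually_at_right_less[of 0]]) (simp add: not_less)
    with freq show False by (simp add: frequently_def)
  qed
  show thesis
  proof
    fix y t assume "(y, t) \<in> Q"
    then have "a \<bullet> y + c * t \<le> a \<bullet> x + c * z" using le eq by simp
    then have "inverse c * (a \<bullet> x + c * z) \<le> inverse c * (a \<bullet> y + c * t)"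
      using \<open>c < 0\<close> by (intro mult_left_mono_neg) auto
    moreover have "inverse c * (c * s) = s" for s using \<open>c < 0\<close> by simp
    ultimately show "z + (a /\<^sub>R c) \<bullet> x \<le> t + (a /\<^sub>R c) \<bullet> y"
      by (simp add: distrib_left)
  qed
qed

definition lower_hull :: "'a::euclidean_space set \<Rightarrow> ('a \<Rightarrow> real) \<Rightarrow> ('a \<times> real) set" where
  "lower_hull A \<nu> = convex hull ((\<lambda>a. (a, \<nu> a)) ` A)"

lemma lower_hull_ge:
  assumes "\<And>a. a \<in> A \<Longrightarrow> m \<le> \<nu> a + u \<bullet> a" and "(x, t) \<in> lower_hull A \<nu>"
  shows "m \<le> t + u \<bullet> x"
proof -
  have "convex hull ((\<lambda>a. (a, \<nu> a)) ` A) \<subseteq> {p. (u, 1) \<bullet> p \<ge> m}"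
    using assms(1) by (intro hull_minimal convex_halfspace_ge) (auto simp: inner_prod_def algebra_simps)
  then show ?thesis using assms(2) by (auto simp: lower_hull_def inner_prod_def)
qed

text \<open>
  The sum of the lower hulls is a polytope. A supporting hyperplane at its lowest point above \<open>x\<close> has a
  slope for which all summands of that point are minimal.
\<close>
lemma exact_sum_of_support:
  assumes fin: "\<And>i. i \<le> n \<Longrightarrow> finite (A i)"
    and supp: "\<And>i. i \<le> n \<Longrightarrow> defined_on_support (A i) (f i)"
  shows "exact_sum n (\<lambda>i. convex hull (A i)) f"
  unfolding exact_sum_def
proof
  fix x assume "x \<in> (\<Sum>i\<le>n. convex hull (A i))"
  then obtain x0 where x0: "\<forall>i\<le>n. x0 i \<in> convex hull (A i)" "(\<Sum>i\<le>n. x0 i) = x"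
    unfolding mem_sum_sets_iff by blast
  have "\<forall>i. \<exists>\<nu>. i \<le> n \<longrightarrow> (\<forall>x\<in>convex hull (A i). (x, f i x) \<in> lower_hull (A i) \<nu> \<and>
          (\<forall>z. (x, z) \<in> lower_hull (A i) \<nu> \<longrightarrow> f i x \<le> z))"
    using supp unfolding defined_on_support_def lower_hull_def by blast
  then obtain \<nu> where \<nu>: "\<And>i x. i \<le> n \<Longrightarrow> x \<in> convex hull (A i) \<Longrightarrow> (x, f i x) \<in> lower_hull (A i) (\<nu> i)"
      "\<And>i x z. i \<le> n \<Longrightarrow> x \<in> convex hull (A i) \<Longrightarrow> (x, z) \<in> lower_hull (A i) (\<nu> i) \<Longrightarrow> f i x \<le> z"
    by metis
  have proj: "y \<in> convex hull (A i)" if "(y, t) \<in> lower_hull (A i) (\<nu> i)" for i y t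
  proof -
    have "fst ` lower_hull (A i) (\<nu> i) = convex hull (A i)"
      unfolding lower_hull_def by (simp add: convex_hull_linear_image[OF linear_fst] image_image)
    then show ?thesis using that by force
  qed
  define Q where "Q = (\<Sum>i\<le>n. lower_hull (A i) (\<nu> i))"
  have polyQ: "polytope Q" unfolding Q_def lower_hull_def by (intro polytope_sum_convex_hulls) (use fin in auto)
  have memQ: "(x, \<Sum>i\<le>n. f i (y i)) \<in> Q"
    if "\<And>i. i \<le> n \<Longrightarrow> y i \<in> convex hull (A i)" "(\<Sum>i\<le>n. y i) = x" for y x
    unfolding Q_def mem_sum_sets_iff
    by (rule exI[of _ "\<lambda>i. (y i, f i (y i))"]) (use that \<nu>(1) in \<open>auto simp: sum_prod\<close>)
  have "\<exists>p\<in>Q \<inter> {p. fst p = x}. \<forall>q\<in>Q \<inter> {p. fst p = x}. snd p \<le> snd q"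
  proof (rule continuous_attains_inf)
    show "compact (Q \<inter> {p. fst p = x})"
      by (intro compact_Int_closed polytope_imp_compact polyQ closed_Collect_eq continuous_intros)
    have "(x, \<Sum>i\<le>n. f i (x0 i)) \<in> Q" using memQ x0 by blast
    then show "Q \<inter> {p. fst p = x} \<noteq> {}" by auto
  qed (intro continuous_intros)
  then obtain z where z: "(x, z) \<in> Q" "\<And>t. (x, t) \<in> Q \<Longrightarrow> z \<le> t"
    by (auto simp: Bex_def Ball_def)
  obtain v where v: "\<And>y t. (y, t) \<in> Q \<Longrightarrow> z + v \<bullet> x \<le> t + v \<bullet> y"
    using polyhedron_lower_support[OF polytope_imp_polyhedron[OF polyQ] z] by blast
  obtain p where p: "\<forall>i\<le>n. p i \<in> lower_hull (A i) (\<nu> i)" "(\<Sum>i\<le>n. p i) = (x, z)"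
    using z(1) unfolding Q_def mem_sum_sets_iff by blast
  let ?y = "\<lambda>i. fst (p i)"
  have yP: "?y i \<in> convex hull (A i)" if "i \<le> n" for i
    using p(1) that proj by (metis prod.collapse)
  have sumy: "(\<Sum>i\<le>n. ?y i) = x" using arg_cong[OF p(2), of fst] by (simp add: fst_sum)
  have fle: "f i (?y i) \<le> snd (p i)" if "i \<le> n" for i
    using \<nu>(2)[OF that yP[OF that], of "snd (p i)"] p(1) that by auto
  have "z \<le> (\<Sum>i\<le>n. f i (?y i))" using z(2) memQ[OF yP sumy] by simp
  moreover have "(\<Sum>i\<le>n. f i (?y i)) \<le> (\<Sum>i\<le>n. snd (p i))" using fle by (intro sum_mono) auto
  moreover have "(\<Sum>i\<le>n. snd (p i)) = z" using arg_cong[OF p(2), of snd] by (simp add: snd_sum)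
  ultimately have zeq: "(\<Sum>i\<le>n. f i (?y i)) = z" by simp
  have "?y i \<in> cell (convex hull (A i)) (f i) v" if i: "i \<le> n" for i
  proof -
    have "f i (?y i) + v \<bullet> ?y i \<le> f i u + v \<bullet> u" if u: "u \<in> convex hull (A i)" for u
    proof -
      let ?u = "?y(i := u)"
      have "z + v \<bullet> x \<le> (\<Sum>j\<le>n. f j (?u j)) + v \<bullet> (\<Sum>j\<le>n. ?u j)"
        by (intro v memQ) (use yP u in auto)
      then show ?thesis
        unfolding sum_fun_upd[OF i, of f] sum_fun_upd[OF i, of "\<lambda>j x. x"] zeq sumy by (simp add: inner_add_right inner_diff_right)
    qed
    then show ?thesis using yP[OF i] by (simp add: cell_def)
  qed
  then show "\<exists>v y. (\<forall>i\<le>n. y i \<in> cell (convex hull (A i)) (f i) v) \<and> (\<Sum>i\<le>n. y i) = x"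
    by (intro exI[of _ v] exI[of _ ?y] conjI sumy) blast
qed

text \<open>
  It suffices to compare \<open>y\<close> with the finitely many points that span the lower hull: those at the height
  of the cell belong to it and do not get lower than \<open>y\<close> by the hypothesis on \<open>u\<close>, and the others are higher by a positive
  amount that a small tilt cannot make up for.
\<close>
lemma tilt_cell:
  assumes fin: "finite A" and supp: "defined_on_support A f"
    and y: "y \<in> cell (convex hull A) f v"
    and min: "\<And>c. c \<in> cell (convex hull A) f v \<Longrightarrow> u \<bullet> y \<le> u \<bullet> c"
  shows "\<forall>\<^sub>F e in at_right 0. y \<in> cell (convex hull A) f (v + e *\<^sub>R u)"
proof -
  obtain \<nu> where \<nu>: "\<And>x. x \<in> convex hull A \<Longrightarrow> (x, f x) \<in> lower_hull A \<nu>"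
      "\<And>x z. x \<in> convex hull A \<Longrightarrow> (x, z) \<in> lower_hull A \<nu> \<Longrightarrow> f x \<le> z"
    using supp unfolding defined_on_support_def lower_hull_def by blast
  let ?m = "f y + v \<bullet> y"
  have ge: "f a \<le> \<nu> a" "a \<in> convex hull A" if "a \<in> A" for a
    using that by (auto intro!: \<nu>(2) simp: lower_hull_def hull_inc)
  have "\<forall>\<^sub>F e in at_right 0. f y + (v + e *\<^sub>R u) \<bullet> y \<le> \<nu> a + (v + e *\<^sub>R u) \<bullet> a" if a: "a \<in> A" for a
  proof (cases "\<nu> a + v \<bullet> a = ?m")
    case True
    then have "f a + v \<bullet> a \<le> ?m" using ge(1)[OF a] by simp
    then have "a \<in> cell (convex hull A) f v"
      using y ge(2)[OF a] unfolding cell_def by fastforce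
    then have uy: "u \<bullet> y \<le> u \<bullet> a" by (rule min)
    show ?thesis
    proof (rule eventually_mono[OF eventually_at_right_less[of 0]])
      fix e :: real assume "0 < e"
      then have "e * (u \<bullet> y) \<le> e * (u \<bullet> a)" using uy by simp
      then show "f y + (v + e *\<^sub>R u) \<bullet> y \<le> \<nu> a + (v + e *\<^sub>R u) \<bullet> a"
        using True by (simp add: inner_add_left)
    qed
  next
    case False
    have "?m \<le> f a + v \<bullet> a" using y ge(2)[OF a] by (auto simp: cell_def)
    then have "?m < \<nu> a + v \<bullet> a" using False ge(1)[OF a] by simp
    moreover have "((\<lambda>e. (\<nu> a + (v + e *\<^sub>R u) \<bullet> a) - (f y + (v + e *\<^sub>R u) \<bullet> y)) \<longlongrightarrow>
        (\<nu> a + (v + 0 *\<^sub>R u) \<bullet> a) - (f y + (v + 0 *\<^sub>R u) \<bullet> y)) (at_right 0)"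
      by (intro tendsto_intros)
    ultimately have "\<forall>\<^sub>F e in at_right 0. 0 < (\<nu> a + (v + e *\<^sub>R u) \<bullet> a) - (f y + (v + e *\<^sub>R u) \<bullet> y)"
      by (intro order_tendstoD(1)) auto
    then show ?thesis by eventually_elim auto
  qed
  then have "\<forall>\<^sub>F e in at_right 0. \<forall>a\<in>A. f y + (v + e *\<^sub>R u) \<bullet> y \<le> \<nu> a + (v + e *\<^sub>R u) \<bullet> a"
    using fin by (simp add: eventually_ball_finite_distrib)
  then show ?thesis
  proof eventually_elim
    case (elim e)
    then have "f y + (v + e *\<^sub>R u) \<bullet> y \<le> f x + (v + e *\<^sub>R u) \<bullet> x" if "x \<in> convex hull A" for x
      using lower_hull_ge[of A _ \<nu>, OF _ \<nu>(1)[OF that]] by blast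
    then show ?case using y by (auto simp: cell_def)
  qed
qed

text \<open>
  If all points of the support were strictly higher than the cell, so would be their convex hull.
  In particular a component consisting of a single point is a point of the support.
\<close>
lemma support_meets_cell:
  assumes fin: "finite A" and supp: "defined_on_support A f"
    and y: "y \<in> cell (convex hull A) f v"
  shows "\<exists>a\<in>A. a \<in> cell (convex hull A) f v"
proof (rule ccontr)
  assume neg: "\<not> ?thesis"
  obtain \<nu> where \<nu>: "\<And>x. x \<in> convex hull A \<Longrightarrow> (x, f x) \<in> lower_hull A \<nu>"
      "\<And>x z. x \<in> convex hull A \<Longrightarrow> (x, z) \<in> lower_hull A \<nu> \<Longrightarrow> f x \<le> z"
    using supp unfolding defined_on_support_def lower_hull_def by blast
  let ?m = "f y + v \<bullet> y"
  have yA: "y \<in> convex hull A" using y by (simp add: cell_def)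
  have "A \<noteq> {}" using yA by auto
  have gt: "?m < \<nu> a + v \<bullet> a" if a: "a \<in> A" for a
  proof -
    have "a \<in> convex hull A" "f a \<le> \<nu> a"
      using a by (auto intro!: \<nu>(2) simp: lower_hull_def hull_inc)
    moreover have "?m < f a + v \<bullet> a"
    proof (rule ccontr)
      assume "\<not> ?thesis"
      then have "a \<in> cell (convex hull A) f v"
        using y \<open>a \<in> convex hull A\<close> unfolding cell_def by fastforce
      then show False using neg a by blast
    qed
    ultimately show ?thesis by simp
  qed
  define t where "t = Min ((\<lambda>a. \<nu> a + v \<bullet> a) ` A)"
  have "t \<le> ?m"
    by (rule lower_hull_ge[OF _ \<nu>(1)[OF yA]]) (simp add: t_def fin)
  moreover have "?m < t" using gt fin \<open>A \<noteq> {}\<close> by (simp add: t_def)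
  ultimately show False by simp
qed

section \<open>Lattices and full-dimensional sets\<close>

lemma lattice_properties:
  assumes "lattice_of_rank n M"
  shows lattice_dim: "dim (span M) = n"
    and lattice_bounded_finite: "bounded S \<Longrightarrow> finite (S \<inter> M)"
proof -
  obtain B where B: "independent B" "card B = n"
      "M = range (\<lambda>k::'a \<Rightarrow> int. \<Sum>b\<in>B. of_int (k b) *\<^sub>R b)"
    using assms unfolding lattice_of_rank_def by blast
  have finB: "finite B" using B(1) by (rule independent_imp_finite)
  have "B \<subseteq> M"
  proof
    fix b assume b: "b \<in> B"
    have "(\<Sum>c\<in>B. of_int (if c = b then 1 else 0) *\<^sub>R c) = (\<Sum>c\<in>B. if c = b then c else 0)"
      by (intro sum.cong) auto
    then have "b = (\<Sum>c\<in>B. of_int ((\<lambda>c. if c = b then 1 else 0) c) *\<^sub>R c)"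
      using b finB by simp
    then show "b \<in> M" unfolding B(3) by (rule range_eqI[where x = "\<lambda>c. if c = b then 1 else 0"])
  qed
  moreover have "M \<subseteq> span B"
  proof
    fix x assume "x \<in> M"
    then obtain k :: "'a \<Rightarrow> int" where x: "x = (\<Sum>b\<in>B. of_int (k b) *\<^sub>R b)" using B(3) by auto
    show "x \<in> span B" unfolding x by (intro span_sum span_scale span_base)
  qed
  ultimately have "span M = span B"
    by (metis span_mono span_span subset_antisym)
  then show "dim (span M) = n" using B(1,2) by (simp add: dim_span dim_eq_card_independent)
  show "finite (S \<inter> M)" if "bounded S"
  proof -
    have "\<exists>g::'a \<Rightarrow> real. linear g \<and> (\<forall>c\<in>B. g c = (if c = b then 1 else 0))" for b
      using linear_independent_extend[OF B(1), of "\<lambda>c. if c = b then 1 else (0::real)"] by auto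
    then obtain g :: "'a \<Rightarrow> 'a \<Rightarrow> real"
      where g: "\<And>b. linear (g b)" "\<And>b c. c \<in> B \<Longrightarrow> g b c = (if c = b then 1 else 0)"
      by metis
    have "\<exists>K. \<forall>x\<in>S. \<bar>g b x\<bar> \<le> K" for b
      using bounded_linear_image[OF that linear_conv_bounded_linear[THEN iffD1, OF g(1)]]
      unfolding bounded_iff by auto
    then obtain K where K: "\<And>b x. x \<in> S \<Longrightarrow> \<bar>g b x\<bar> \<le> K b" by metis
    have "S \<inter> M \<subseteq> (\<lambda>k. \<Sum>b\<in>B. of_int (k b) *\<^sub>R b) ` (\<Pi>\<^sub>E b\<in>B. {- \<lceil>K b\<rceil>..\<lceil>K b\<rceil>})"
    proof
      fix x assume x: "x \<in> S \<inter> M"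
      then obtain k :: "'a \<Rightarrow> int" where k: "x = (\<Sum>b\<in>B. of_int (k b) *\<^sub>R b)" using B(3) by auto
      have "of_int (k b) = g b x" if b: "b \<in> B" for b
      proof -
        have "g b x = (\<Sum>c\<in>B. of_int (k c) * (if c = b then 1 else 0))"
          unfolding k by (simp add: linear_sum[OF g(1)] linear_cmul[OF g(1)] g(2) cong: sum.cong)
        also have "\<dots> = (\<Sum>c\<in>B. if c = b then of_int (k c) else 0)" by (intro sum.cong) auto
        also have "\<dots> = of_int (k b)" using b finB by simp
        finally show ?thesis by simp
      qed
      then have "\<bar>of_int (k b)\<bar> \<le> K b" if "b \<in> B" for b using K x that by simp
      then have "- \<lceil>K b\<rceil> \<le> k b \<and> k b \<le> \<lceil>K b\<rceil>" if "b \<in> B" for b using that by (smt (verit) of_int_abs le_of_int_ceiling of_int_le_iff of_int_minus)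
      then show "x \<in> (\<lambda>k. \<Sum>b\<in>B. of_int (k b) *\<^sub>R b) ` (\<Pi>\<^sub>E b\<in>B. {- \<lceil>K b\<rceil>..\<lceil>K b\<rceil>})"
        unfolding k by (intro image_eqI[of _ _ "restrict k B"]) (auto cong: sum.cong)
    qed
    moreover have "finite ((\<lambda>k. \<Sum>b\<in>B. of_int (k b) *\<^sub>R b) ` (\<Pi>\<^sub>E b\<in>B. {- \<lceil>K b\<rceil>..\<lceil>K b\<rceil>}))"
      using finB by (intro finite_imageI finite_PiE) auto
    ultimately show ?thesis by (rule finite_subset)
  qed
qed

lemma orthogonal_of_full_dim_level_set:
  fixes E :: "'a::euclidean_space set"
  assumes V: "subspace V" and E: "E \<subseteq> V" "aff_dim E \<ge> int (dim V)"
    and const: "\<And>y. y \<in> E \<Longrightarrow> u \<bullet> y = c" and m: "m \<in> V"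
  shows "u \<bullet> m = 0"
proof -
  have "affine hull E \<subseteq> V"
    using E(1) V by (simp add: hull_minimal subspace_imp_affine)
  moreover have "aff_dim (affine hull E) = aff_dim V"
    using aff_dim_subset[OF E(1)] E(2) by (simp add: aff_dim_subspace V)
  moreover have "E \<noteq> {}" using E(2) by auto
  ultimately have hull: "affine hull E = V"
    by (intro affine_dim_equal) (auto simp: affine_affine_hull subspace_imp_affine V)
  have "affine hull E \<subseteq> {y. u \<bullet> y = c}"
    using const by (intro hull_minimal affine_hyperplane) auto
  then have "u \<bullet> 0 = c" "u \<bullet> m = c"
    using subspace_0[OF V] m unfolding hull by blast+
  then show ?thesis by simp
qed

lemma cell_eq_of_orthogonal:
  assumes "P \<subseteq> V" "\<And>m. m \<in> V \<Longrightarrow> (w' - w) \<bullet> m = 0"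
  shows "cell P f w' = cell P f w"
proof -
  have "w' \<bullet> m = w \<bullet> m" if "m \<in> P" for m
    using assms that by (auto simp: inner_diff_left)
  then show ?thesis by (auto simp: cell_def)
qed

section \<open>Piecewise affine functions\<close>

text \<open>
  A cell meets each polytope of an affine piece in a face of that polytope, so it is a union of faces
  from a finite collection.
\<close>
lemma finite_cells:
  assumes "convex_piecewise_affine_on P f"
  shows "finite (range (cell P f))"
proof -
  obtain \<Q> where Q: "finite \<Q>" "\<Union>\<Q> = P"
      "\<And>Q. Q \<in> \<Q> \<Longrightarrow> polytope Q \<and> (\<exists>v c. \<forall>x\<in>Q. f x = v \<bullet> x + c)"
    using assms unfolding convex_piecewise_affine_on_def by blast
  define F where "F = (\<Union>Q\<in>\<Q>. {T. T face_of Q})"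
  have "finite F" using Q finite_polytope_faces by (auto simp: F_def)
  have "cell P f w \<in> Union ` Pow F" for w
  proof -
    have "\<exists>T\<in>F. x \<in> T \<and> T \<subseteq> cell P f w" if x: "x \<in> cell P f w" for x
    proof -
      obtain q where q: "q \<in> \<Q>" "x \<in> q" using x Q(2) cell_subset by blast
      then obtain v c where vc: "\<forall>x\<in>q. f x = v \<bullet> x + c" using Q(3) by blast
      have sub: "q \<subseteq> P" using q(1) Q(2) by blast
      let ?b = "(v + w) \<bullet> x"
      have ge: "(v + w) \<bullet> y \<ge> ?b" if "y \<in> q" for y
      proof -
        have "f x + w \<bullet> x \<le> f y + w \<bullet> y" using x sub that by (auto simp: cell_def)
        then show ?thesis using vc q(2) that by (simp add: inner_add_left)
      qed
      have "convex q" using Q(3)[OF q(1)] polytope_imp_convex by blast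
      then have "(q \<inter> {y. (v + w) \<bullet> y = ?b}) face_of q"
        by (rule face_of_Int_supporting_hyperplane_ge) (rule ge)
      then have "q \<inter> {y. (v + w) \<bullet> y = ?b} \<in> F" using q(1) by (auto simp: F_def)
      moreover have "q \<inter> {y. (v + w) \<bullet> y = ?b} \<subseteq> cell P f w"
      proof
        fix y assume y: "y \<in> q \<inter> {y. (v + w) \<bullet> y = ?b}"
        then have "f y + w \<bullet> y = f x + w \<bullet> x" using vc q(2) by (simp add: inner_add_left)
        moreover have "y \<in> P" using y sub by blast
        ultimately show "y \<in> cell P f w" using x by (simp add: cell_def)
      qed
      ultimately show ?thesis using q(2) by (intro bexI[of _ "q \<inter> {y. (v + w) \<bullet> y = ?b}"]) auto
    qed
    then have "cell P f w = \<Union>{T \<in> F. T \<subseteq> cell P f w}" by blast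
    then show ?thesis by (rule image_eqI) auto
  qed
  then have "range (cell P f) \<subseteq> Union ` Pow F" by blast
  then show ?thesis using \<open>finite F\<close> by (meson finite_Pow_iff finite_imageI finite_subset)
qed

lemma piecewise_affine_bounded_below:
  assumes "convex_piecewise_affine_on P f"
  obtains m where "\<And>x. x \<in> P \<Longrightarrow> m \<le> f x"
proof -
  obtain \<Q> where Q: "finite \<Q>" "\<Union>\<Q> = P"
      "\<And>Q. Q \<in> \<Q> \<Longrightarrow> polytope Q \<and> (\<exists>v c. \<forall>x\<in>Q. f x = v \<bullet> x + c)"
    using assms unfolding convex_piecewise_affine_on_def by blast
  have "bdd_below (f ` q)" if q: "q \<in> \<Q>" for q
  proof -
    obtain v c where vc: "\<forall>x\<in>q. f x = v \<bullet> x + c" using Q(3) q by blast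
    have "compact ((\<lambda>x. v \<bullet> x + c) ` q)"
      using Q(3)[OF q] by (intro compact_continuous_image continuous_intros polytope_imp_compact) auto
    moreover have "(\<lambda>x. v \<bullet> x + c) ` q = f ` q" using vc by auto
    ultimately show ?thesis by (auto intro: bounded_imp_bdd_below compact_imp_bounded)
  qed
  then have "bdd_below (\<Union>q\<in>\<Q>. f ` q)" using Q(1) by (simp add: bdd_below_UN)
  then have "bdd_below (f ` P)" using Q(2) by (simp flip: image_Union)
  then show thesis using that by (auto simp: bdd_below_def)
qed

section \<open>The Canny-Emiris data at a generic shift\<close>

locale canny_emiris =
  fixes n :: nat
    and M :: "'a::euclidean_space set"
    and A \<Delta> :: "nat \<Rightarrow> 'a set"
    and \<rho> :: "nat \<Rightarrow> 'a \<Rightarrow> real"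
    and \<delta> :: 'a
  assumes lattice: "lattice_of_rank n M"
    and A: "\<And>i. i \<le> n \<Longrightarrow> A i \<noteq> {} \<and> finite (A i) \<and> A i \<subseteq> M"
    and \<Delta>: "\<And>i. i \<le> n \<Longrightarrow> \<Delta> i = convex hull (A i)"
    and supp: "\<And>i. i \<le> n \<Longrightarrow> defined_on_support (A i) (\<rho> i)"
    and tight: "tight_mixed n \<Delta> \<rho>"
    and generic: "generic_shift n M \<Delta> \<rho> \<delta>"
begin

lemma finA: "i \<le> n \<Longrightarrow> finite (A i)" using A by blast

lemma \<Delta>_subset_span: "i \<le> n \<Longrightarrow> \<Delta> i \<subseteq> span M"
  using A span_superset[of M] unfolding \<Delta>
  by (intro hull_minimal subspace_imp_convex subspace_span) blast+

lemma sum_subset_span: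
  assumes "\<And>i. i \<le> n \<Longrightarrow> P i \<subseteq> \<Delta> i"
  shows "(\<Sum>i\<le>n. P i) \<subseteq> span M"
proof
  fix x assume "x \<in> (\<Sum>i\<le>n. P i)"
  then obtain y where "\<forall>i\<le>n. y i \<in> P i" "(\<Sum>i\<le>n. y i) = x" unfolding mem_sum_sets_iff by blast
  then show "x \<in> span M"
    using assms \<Delta>_subset_span by (metis atMost_iff span_sum subset_iff)
qed

lemma finite_index:
  assumes "\<And>i. i \<le> n \<Longrightarrow> P i \<subseteq> \<Delta> i"
  shows "finite (ce_index n M P \<delta>)"
proof -
  have "polytope (\<Sum>i\<le>n. convex hull (A i))" by (rule polytope_sum_convex_hulls) (rule finA)
  moreover have "(\<Sum>i\<le>n. P i) \<subseteq> (\<Sum>i\<le>n. convex hull (A i))"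
    using assms \<Delta> by (intro sum_sets_mono) auto
  ultimately have "bounded (\<Sum>i\<le>n. P i)"
    using polytope_imp_bounded bounded_subset by blast
  then show ?thesis
    unfolding ce_index_def using lattice_bounded_finite[OF lattice] bounded_translation by blast
qed

lemma exact_\<rho>: "exact_sum n \<Delta> \<rho>"
proof -
  have "exact_sum n (\<lambda>i. convex hull (A i)) \<rho>" by (rule exact_sum_of_support[OF finA supp])
  moreover have "(\<Sum>i\<le>n. \<Delta> i) = (\<Sum>i\<le>n. convex hull (A i))" by (intro sum.cong) (auto simp: \<Delta>)
  ultimately show ?thesis unfolding exact_sum_def by (metis \<Delta>)
qed

text \<open>
  The point \<open>b - \<delta>\<close> lies in the cell of slope \<open>v\<close>, as the optimal sum of the points \<open>y i\<close>.
\<close>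
definition decomposes :: "'a \<Rightarrow> 'a \<Rightarrow> (nat \<Rightarrow> 'a) \<Rightarrow> bool" where
  "decomposes b v y \<longleftrightarrow> b \<in> M \<and> \<delta> + (\<Sum>i\<le>n. y i) = b \<and> (\<forall>i\<le>n. y i \<in> cell (\<Delta> i) (\<rho> i) v)"

lemma decomposes_exists:
  assumes "b \<in> ce_index n M \<Delta> \<delta>"
  obtains v y where "decomposes b v y"
proof -
  obtain x where "x \<in> (\<Sum>i\<le>n. \<Delta> i)" "b = \<delta> + x" "b \<in> M" using assms by (auto simp: ce_index_def)
  then show thesis using exact_\<rho> that unfolding exact_sum_def decomposes_def by metis
qed

lemma generic_cell_dim:
  assumes "C \<in> mixed_subdivision n \<Delta> \<rho>" "x \<in> C" "\<delta> + x \<in> M"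
  shows "aff_dim C \<ge> int n"
proof (rule ccontr)
  assume "\<not> ?thesis"
  then have "aff_dim C \<le> int n - 1" by simp
  then show False using generic assms unfolding generic_shift_def by blast
qed

text \<open>
  A small tilt by \<open>u\<close> keeps the summands \<open>y i\<close> minimal. The cell for half of this tilt contains \<open>b - \<delta>\<close>
  and is the intersection of the cells for no tilt and for the whole tilt, so \<open>u\<close> is constant on it. By
  genericity it has full dimension.
\<close>
lemma generic_tilt_orthogonal:
  assumes s: "decomposes b v y"
    and min: "\<And>i c. i \<le> n \<Longrightarrow> c \<in> cell (\<Delta> i) (\<rho> i) v \<Longrightarrow> u \<bullet> y i \<le> u \<bullet> c"
    and m: "m \<in> span M"
  shows "u \<bullet> m = 0"
proof -
  let ?R = "inf_conv n \<Delta> \<rho>" and ?S = "\<Sum>i\<le>n. \<Delta> i" and ?x = "\<Sum>i\<le>n. y i"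
  have y: "\<And>i. i \<le> n \<Longrightarrow> y i \<in> cell (\<Delta> i) (\<rho> i) v" using s by (auto simp: decomposes_def)
  have "\<forall>\<^sub>F e in at_right 0. y i \<in> cell (\<Delta> i) (\<rho> i) (v + e *\<^sub>R u)" if "i \<le> n" for i
    unfolding \<Delta>[OF that]
    by (rule tilt_cell) (use finA supp y min that \<Delta> in auto)
  then have "\<forall>\<^sub>F e in at_right 0. \<forall>i\<in>{..n}. y i \<in> cell (\<Delta> i) (\<rho> i) (v + e *\<^sub>R u)"
    by (simp add: eventually_ball_finite_distrib)
  then have "\<forall>\<^sub>F e in at_right 0. e > 0 \<and> (\<forall>i\<in>{..n}. y i \<in> cell (\<Delta> i) (\<rho> i) (v + e *\<^sub>R u))"
    using eventually_at_right_less eventually_conj by blast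
  then obtain e where e: "e > 0" "\<forall>i\<le>n. y i \<in> cell (\<Delta> i) (\<rho> i) (v + e *\<^sub>R u)"
    using eventually_happens'[OF trivial_limit_at_right_real, where P = "\<lambda>e. e > 0 \<and> (\<forall>i\<in>{..n}. y i \<in> cell (\<Delta> i) (\<rho> i) (v + e *\<^sub>R u))"]
    unfolding Ball_def atMost_iff by blast
  have x0: "?x \<in> cell ?S ?R v" and x1: "?x \<in> cell ?S ?R (v + e *\<^sub>R u)"
    using y e by (auto intro!: sum_mem_cell)
  \<comment> \<open>as \<open>?x\<close> is minimal for \<open>v\<close> and \<open>v + e u\<close>, the points minimal for their mean are minimal for both\<close>
  let ?E = "cell ?S ?R (v + (e / 2) *\<^sub>R u)"
  have xE: "?x \<in> ?E"
    unfolding cell_def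
  proof (intro CollectI conjI ballI)
    show "?x \<in> ?S" using x0 cell_subset by blast
    fix z assume z: "z \<in> ?S"
    have "?R ?x + v \<bullet> ?x \<le> ?R z + v \<bullet> z"
      and "?R ?x + (v + e *\<^sub>R u) \<bullet> ?x \<le> ?R z + (v + e *\<^sub>R u) \<bullet> z"
      using x0 x1 z by (auto simp: cell_def)
    then show "?R ?x + (v + (e / 2) *\<^sub>R u) \<bullet> ?x \<le> ?R z + (v + (e / 2) *\<^sub>R u) \<bullet> z"
      by (simp add: inner_add_left)
  qed
  have "u \<bullet> z = u \<bullet> ?x" if z: "z \<in> ?E" for z
  proof -
    have zS: "z \<in> ?S" "?x \<in> ?S" using z x0 by (auto simp: cell_def)
    have "?R ?x + v \<bullet> ?x \<le> ?R z + v \<bullet> z"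
      and "?R ?x + (v + e *\<^sub>R u) \<bullet> ?x \<le> ?R z + (v + e *\<^sub>R u) \<bullet> z"
      and "?R z + (v + (e / 2) *\<^sub>R u) \<bullet> z \<le> ?R ?x + (v + (e / 2) *\<^sub>R u) \<bullet> ?x"
      using x0 x1 z zS by (auto simp: cell_def)
    then have "?R ?x + v \<bullet> ?x \<le> ?R z + v \<bullet> z"
      "?R ?x + v \<bullet> ?x + e * (u \<bullet> ?x) \<le> ?R z + v \<bullet> z + e * (u \<bullet> z)"
      "?R z + v \<bullet> z + e * (u \<bullet> z) / 2 \<le> ?R ?x + v \<bullet> ?x + e * (u \<bullet> ?x) / 2"
      by (simp_all add: inner_add_left)
    then have "e * (u \<bullet> z) = e * (u \<bullet> ?x)" by linarith
    then show ?thesis using e(1) by simp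
  qed
  moreover have "aff_dim ?E \<ge> int (dim (span M))"
    unfolding lattice_dim[OF lattice]
    by (rule generic_cell_dim[OF _ xE]) (use s in \<open>auto simp: mixed_subdivision_def subdivision_def decomposes_def\<close>)
  moreover have "?E \<subseteq> span M" using cell_subset sum_subset_span by blast
  ultimately show ?thesis
    using orthogonal_of_full_dim_level_set[of "span M" ?E u "u \<bullet> ?x" m] m by (simp add: subspace_span)
qed

text \<open>
  Stated for subsets \<open>P i\<close> of the polytopes that still contain the cells of slope \<open>v\<close>, so that it covers both the
  original data and a restriction: any top-dimensional cell through \<open>b - \<delta>\<close> has a slope that
  differs from \<open>v\<close> by a functional as in the preceding lemma.
\<close>
lemma ce_cell_eq:
  assumes s: "decomposes b v y"
    and P: "\<And>i. i \<le> n \<Longrightarrow> P i \<subseteq> \<Delta> i" "\<And>i. i \<le> n \<Longrightarrow> cell (\<Delta> i) (\<rho> i) v \<subseteq> P i"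
    and ex: "exact_sum n P \<rho>"
  shows "ce_cell n P \<rho> \<delta> b \<in> top_cells n P \<rho>"
    and "i \<le> n \<Longrightarrow> component n P \<rho> (ce_cell n P \<rho> \<delta> b) i = cell (\<Delta> i) (\<rho> i) v"
proof -
  let ?x = "\<Sum>i\<le>n. y i" and ?C = "cell (\<Sum>i\<le>n. P i) (inf_conv n P \<rho>) v"
  have y: "\<And>i. i \<le> n \<Longrightarrow> y i \<in> cell (\<Delta> i) (\<rho> i) v" using s by (auto simp: decomposes_def)
  have cells: "cell (P i) (\<rho> i) v = cell (\<Delta> i) (\<rho> i) v" if "i \<le> n" for i
    using P[OF that] y[OF that] by (intro cell_restrict) auto
  have yP: "\<And>i. i \<le> n \<Longrightarrow> y i \<in> cell (P i) (\<rho> i) v" using y cells by auto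
  have xC: "?x \<in> ?C" using yP by (rule sum_mem_cell)
  have "?C = cell (\<Sum>i\<le>n. \<Delta> i) (inf_conv n \<Delta> \<rho>) v"
    unfolding cell_eq_sum_cells[OF ex] cell_eq_sum_cells[OF exact_\<rho>]
    by (intro sum.cong) (auto simp: cells)
  then have "?C \<in> mixed_subdivision n \<Delta> \<rho>" by (auto simp: mixed_subdivision_def subdivision_def)
  then have "aff_dim ?C \<ge> int n"
    by (rule generic_cell_dim[OF _ xC]) (use s in \<open>auto simp: decomposes_def\<close>)
  moreover have "?C \<subseteq> span M" using cell_subset sum_subset_span[of P] P(1) by blast
  then have "aff_dim ?C \<le> int n"
    using aff_dim_subset[of ?C "span M"] lattice_dim[OF lattice]
    by (simp add: aff_dim_subspace subspace_span)
  ultimately have top: "?C \<in> top_cells n P \<rho>"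
    by (auto simp: top_cells_def mixed_subdivision_def subdivision_def)
  have "ce_cell n P \<rho> \<delta> b = ?C"
    unfolding ce_cell_def
  proof (rule the_equality)
    show "?C \<in> top_cells n P \<rho> \<and> b \<in> (+) \<delta> ` ?C"
      using top xC s by (auto simp: decomposes_def)
  next
    fix C' assume C': "C' \<in> top_cells n P \<rho> \<and> b \<in> (+) \<delta> ` C'"
    then obtain v' where v': "C' = cell (\<Sum>i\<le>n. P i) (inf_conv n P \<rho>) v'"
      by (auto simp: top_cells_def mixed_subdivision_def subdivision_def)
    have "?x \<in> C'" using C' s by (auto simp: decomposes_def)
    have "y i \<in> cell (P i) (\<rho> i) v'" if "i \<le> n" for i
    proof (rule summands_mem_cells[where m = "\<lambda>j. \<rho> j (y j) + v \<bullet> y j" and v = v and y = y])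
      show "inf_conv n P \<rho> ?x = (\<Sum>i\<le>n. \<rho> i (y i))"
        using yP by (rule inf_conv_eq_of_mem_cells)
    qed (use yP that \<open>?x \<in> C'\<close> v' in \<open>auto simp: cell_def\<close>)
    then have "(v' - v) \<bullet> y i \<le> (v' - v) \<bullet> c" if "i \<le> n" "c \<in> cell (\<Delta> i) (\<rho> i) v" for i c
      using tilt_minimal[of "y i" "P i" "\<rho> i" v' v c] yP cells that by auto
    then have orth: "(v' - v) \<bullet> m = 0" if "m \<in> span M" for m
      using generic_tilt_orthogonal[OF s _ that, of "v' - v"] by blast
    show "C' = ?C"
      unfolding v' by (rule cell_eq_of_orthogonal[OF sum_subset_span[OF P(1)] orth])
  qed
  then show "ce_cell n P \<rho> \<delta> b \<in> top_cells n P \<rho>"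
    and "i \<le> n \<Longrightarrow> component n P \<rho> (ce_cell n P \<rho> \<delta> b) i = cell (\<Delta> i) (\<rho> i) v"
    using top component_eq_cell[of n y P \<rho> v i, OF yP] cells by auto
qed

text \<open>
  By tightness the \<open>n + 1\<close> dimensions of the components add up to \<open>n\<close>, so one of them is \<open>0\<close> and the
  row index exists.
\<close>
lemma ce_row_properties:
  assumes s: "decomposes b v y"
  defines "i \<equiv> ce_row n \<Delta> \<rho> \<delta> b"
  shows ce_row_le: "i \<le> n"
    and ce_row_cell: "cell (\<Delta> i) (\<rho> i) v = {ce_point n \<Delta> \<rho> \<delta> b}"
    and ce_point_mem: "ce_point n \<Delta> \<rho> \<delta> b \<in> A i"
proof -
  let ?C = "ce_cell n \<Delta> \<rho> \<delta> b"
  have comp: "component n \<Delta> \<rho> ?C j = cell (\<Delta> j) (\<rho> j) v" if "j \<le> n" for j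
    using ce_cell_eq(2)[OF s _ _ exact_\<rho> that] cell_subset by blast
  have y: "\<And>i. i \<le> n \<Longrightarrow> y i \<in> cell (\<Delta> i) (\<rho> i) v" using s by (auto simp: decomposes_def)
  have "?C \<in> top_cells n \<Delta> \<rho>"
    using ce_cell_eq(1)[OF s _ _ exact_\<rho>] cell_subset by blast
  then have tot: "(\<Sum>j\<le>n. aff_dim (component n \<Delta> \<rho> ?C j)) = int n"
    using tight by (auto simp: tight_mixed_def)
  have "\<exists>j\<le>n. aff_dim (component n \<Delta> \<rho> ?C j) = 0"
  proof (rule ccontr)
    assume neg: "\<not> ?thesis"
    have "aff_dim (component n \<Delta> \<rho> ?C j) \<ge> 1" if "j \<le> n" for j
    proof -
      have "aff_dim (component n \<Delta> \<rho> ?C j) \<noteq> -1"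
        using comp[OF that] y[OF that] by (auto simp: aff_dim_empty[symmetric])
      then show ?thesis using neg that aff_dim_geq[of "component n \<Delta> \<rho> ?C j"] by force
    qed
    then have "(\<Sum>j\<le>n. 1) \<le> (\<Sum>j\<le>n. aff_dim (component n \<Delta> \<rho> ?C j))" by (intro sum_mono) auto
    then show False using tot by simp
  qed
  then have "i \<le> n \<and> aff_dim (component n \<Delta> \<rho> ?C i) = 0"
    unfolding i_def ce_row_def
    by (elim exE) (rule GreatestI_nat[where b = n], auto)
  then obtain p where i: "i \<le> n" and p: "component n \<Delta> \<rho> ?C i = {p}"
    using aff_dim_eq_0 by blast
  have "ce_point n \<Delta> \<rho> \<delta> b = p"
    unfolding ce_point_def i_def[symmetric] p by simp
  then show "i \<le> n" and cell: "cell (\<Delta> i) (\<rho> i) v = {ce_point n \<Delta> \<rho> \<delta> b}"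
    using i p comp[OF i] by auto
  show "ce_point n \<Delta> \<rho> \<delta> b \<in> A i"
    using support_meets_cell[OF finA[OF i] supp[OF i], of "y i" v] y[OF i] cell unfolding \<Delta>[OF i] by auto
qed

lemma ce_row_restrict:
  assumes s: "decomposes b v y"
    and P: "\<And>i. i \<le> n \<Longrightarrow> P i \<subseteq> \<Delta> i" "\<And>i. i \<le> n \<Longrightarrow> cell (\<Delta> i) (\<rho> i) v \<subseteq> P i"
    and ex: "exact_sum n P \<rho>"
  shows "ce_row n P \<rho> \<delta> b = ce_row n \<Delta> \<rho> \<delta> b" "ce_point n P \<rho> \<delta> b = ce_point n \<Delta> \<rho> \<delta> b"
proof -
  have eq: "component n P \<rho> (ce_cell n P \<rho> \<delta> b) j = component n \<Delta> \<rho> (ce_cell n \<Delta> \<rho> \<delta> b) j"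
    if "j \<le> n" for j
    using ce_cell_eq(2)[OF s P ex that] ce_cell_eq(2)[OF s _ _ exact_\<rho> that] cell_subset by blast
  then show row: "ce_row n P \<rho> \<delta> b = ce_row n \<Delta> \<rho> \<delta> b"
    unfolding ce_row_def by (metis (no_types, lifting))
  show "ce_point n P \<rho> \<delta> b = ce_point n \<Delta> \<rho> \<delta> b"
    unfolding ce_point_def row using eq ce_row_le[OF s] by simp
qed

end

section \<open>The potential of a coarser subdivision\<close>

locale ce_coarsening = canny_emiris +
  fixes \<phi> :: "nat \<Rightarrow> 'a \<Rightarrow> real"
  assumes piecewise: "\<And>i. i \<le> n \<Longrightarrow> convex_piecewise_affine_on (\<Delta> i) (\<phi> i)"
    and coarser: "coarser n \<Delta> \<phi> \<rho>"
begin

abbreviation "\<Phi> \<equiv> inf_conv n \<Delta> \<phi>"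

text \<open>
  The slopes \<open>v\<close> for \<open>\<rho>\<close> and \<open>w\<close> for \<open>\<phi>\<close> belong to cells of which the first lies in the second, with its
  components. Only the components are compared, as the cells are the sums of their components.
\<close>
definition carries :: "'a \<Rightarrow> 'a \<Rightarrow> bool" where
  "carries v w \<longleftrightarrow> (\<forall>i\<le>n. cell (\<Delta> i) (\<rho> i) v \<subseteq> cell (\<Delta> i) (\<phi> i) w)"

lemma carriesD: "carries v w \<Longrightarrow> i \<le> n \<Longrightarrow> c \<in> cell (\<Delta> i) (\<rho> i) v \<Longrightarrow> c \<in> cell (\<Delta> i) (\<phi> i) w"
  by (auto simp: carries_def)

lemma \<phi>_bounded_below:
  obtains m where "\<And>i z. i \<le> n \<Longrightarrow> z \<in> \<Delta> i \<Longrightarrow> m i \<le> \<phi> i z + 0 \<bullet> z"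
proof -
  have "\<exists>m. \<forall>z\<in>\<Delta> i. m \<le> \<phi> i z" if "i \<le> n" for i
    using piecewise_affine_bounded_below[OF piecewise[OF that]] by metis
  then obtain m where "\<And>i. i \<le> n \<Longrightarrow> \<forall>z\<in>\<Delta> i. m i \<le> \<phi> i z" by metis
  then show thesis by (intro that[of m]) auto
qed

lemma \<Phi>_le: "(\<And>i. i \<le> n \<Longrightarrow> z i \<in> \<Delta> i) \<Longrightarrow> \<Phi> (\<Sum>i\<le>n. z i) \<le> (\<Sum>i\<le>n. \<phi> i (z i))"
  using \<phi>_bounded_below inf_conv_le[of n \<Delta> _ \<phi> 0 z] by metis

lemma \<phi>_summands_mem_cells:
  assumes "\<And>i. i \<le> n \<Longrightarrow> y i \<in> \<Delta> i" "\<Phi> (\<Sum>i\<le>n. y i) = (\<Sum>i\<le>n. \<phi> i (y i))"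
    and "(\<Sum>i\<le>n. y i) \<in> cell (\<Sum>i\<le>n. \<Delta> i) \<Phi> w" "i \<le> n"
  shows "y i \<in> cell (\<Delta> i) (\<phi> i) w"
proof -
  obtain m where m: "\<And>i z. i \<le> n \<Longrightarrow> z \<in> \<Delta> i \<Longrightarrow> m i \<le> \<phi> i z + 0 \<bullet> z"
    by (rule \<phi>_bounded_below) (rule that; blast)
  show ?thesis by (rule summands_mem_cells[OF m assms])
qed

text \<open>
  The components of a cell are the cells of the single functions for the same slope, so the inclusion
  of components that comes with a coarser subdivision is an inclusion of cells.
\<close>
lemma carries_exists:
  assumes y: "\<And>i. i \<le> n \<Longrightarrow> y i \<in> cell (\<Delta> i) (\<rho> i) v"
  obtains w where "carries v w"
proof -
  let ?C = "cell (\<Sum>i\<le>n. \<Delta> i) (inf_conv n \<Delta> \<rho>) v"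
  have "?C \<in> mixed_subdivision n \<Delta> \<rho>" by (auto simp: mixed_subdivision_def subdivision_def)
  then obtain D where D: "D \<in> mixed_subdivision n \<Delta> \<phi>"
      "\<And>i. i \<le> n \<Longrightarrow> component n \<Delta> \<rho> ?C i \<subseteq> component n \<Delta> \<phi> D i"
    using coarser unfolding coarser_def by blast
  then obtain w where w: "D = cell (\<Sum>i\<le>n. \<Delta> i) \<Phi> w"
    by (auto simp: mixed_subdivision_def subdivision_def)
  have "component n \<Delta> \<phi> D i \<subseteq> cell (\<Delta> i) (\<phi> i) w" if "i \<le> n" for i
    unfolding component_def w using \<phi>_summands_mem_cells that by auto
  then have "carries v w"
    using D(2) component_eq_cell[of n y \<Delta> \<rho> v, OF y] by (fastforce simp: carries_def)
  then show thesis using that by blast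
qed

lemma exact_\<phi>: "exact_sum n \<Delta> \<phi>"
  unfolding exact_sum_def
proof
  fix x assume "x \<in> (\<Sum>i\<le>n. \<Delta> i)"
  then obtain v y where y: "\<And>i. i \<le> n \<Longrightarrow> y i \<in> cell (\<Delta> i) (\<rho> i) v" "(\<Sum>i\<le>n. y i) = x"
    using exact_\<rho> unfolding exact_sum_def by blast
  obtain w where "carries v w" using carries_exists y(1) by blast
  then show "\<exists>v y. (\<forall>i\<le>n. y i \<in> cell (\<Delta> i) (\<phi> i) v) \<and> (\<Sum>i\<le>n. y i) = x"
    using carriesD y by blast
qed

text \<open>
  On each cell of slope \<open>v\<close> the functional \<open>w' - w\<close> is smallest at \<open>y i\<close>, either because the cell is a
  point or because \<open>w\<close> makes the whole cell minimal and \<open>w'\<close> makes \<open>y i\<close> minimal. The case of a point is what the row index of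
  the Canny-Emiris matrix provides.
\<close>
lemma carried_slope_unique:
  assumes s: "decomposes b v y" and w: "carries v w"
    and w': "\<And>i. i \<le> n \<Longrightarrow> y i \<in> cell (\<Delta> i) (\<phi> i) w' \<or> cell (\<Delta> i) (\<rho> i) v = {y i}"
    and i: "i \<le> n"
  shows "cell (\<Delta> i) (\<phi> i) w' = cell (\<Delta> i) (\<phi> i) w"
proof -
  have "(w' - w) \<bullet> y j \<le> (w' - w) \<bullet> c" if "j \<le> n" "c \<in> cell (\<Delta> j) (\<rho> j) v" for j c
  proof (cases "cell (\<Delta> j) (\<rho> j) v = {y j}")
    case False
    have "y j \<in> cell (\<Delta> j) (\<rho> j) v" using s that by (auto simp: decomposes_def)
    then show ?thesis
      using tilt_minimal[of "y j" "\<Delta> j" "\<phi> j" w' w c] w'[OF that(1)] False carriesD[OF w that(1)] that(2)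
      by blast
  qed (use that in auto)
  then have "(w' - w) \<bullet> m = 0" if "m \<in> span M" for m
    using generic_tilt_orthogonal[OF s _ that] by blast
  then show ?thesis using cell_eq_of_orthogonal[OF \<Delta>_subset_span[OF i]] by blast
qed

lemma carried_point_mem:
  assumes s: "decomposes b v y" and w: "carries v w"
  shows "b - \<delta> = (\<Sum>i\<le>n. y i)" "i \<le> n \<Longrightarrow> y i \<in> cell (\<Delta> i) (\<phi> i) w" "i \<le> n \<Longrightarrow> y i \<in> \<Delta> i"
    and "b - \<delta> \<in> cell (\<Sum>i\<le>n. \<Delta> i) \<Phi> w" "\<Phi> (b - \<delta>) = (\<Sum>i\<le>n. \<phi> i (y i))"
proof -
  show x: "b - \<delta> = (\<Sum>i\<le>n. y i)" using s by (auto simp: decomposes_def)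
  have y: "\<And>i. i \<le> n \<Longrightarrow> y i \<in> cell (\<Delta> i) (\<phi> i) w"
    using s carriesD[OF w] by (auto simp: decomposes_def)
  then show "i \<le> n \<Longrightarrow> y i \<in> cell (\<Delta> i) (\<phi> i) w" "i \<le> n \<Longrightarrow> y i \<in> \<Delta> i"
    using cell_subset by blast+
  show "b - \<delta> \<in> cell (\<Sum>i\<le>n. \<Delta> i) \<Phi> w" unfolding x using y by (rule sum_mem_cell)
  show "\<Phi> (b - \<delta>) = (\<Sum>i\<le>n. \<phi> i (y i))" unfolding x using y by (rule inf_conv_eq_of_mem_cells)
qed

text \<open>
  With \<open>a\<close> replaced by \<open>c - b + a\<close>, the optimal sum for \<open>b - \<delta>\<close> becomes a sum for \<open>c - \<delta>\<close>. If it is still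
  optimal, its summands other than the replaced one are minimal for two slopes, those of the
  cells of \<open>b - \<delta>\<close> and of \<open>c - \<delta>\<close>, which therefore define the same cells.
\<close>
lemma potential:
  fixes b c
  defines "i \<equiv> ce_row n \<Delta> \<rho> \<delta> b" and "a \<equiv> ce_point n \<Delta> \<rho> \<delta> b"
  assumes s: "decomposes b v y" and w: "carries v w"
    and c: "c \<in> ce_index n M \<Delta> \<delta>" and a': "c - b + a \<in> A i"
  shows potential_le: "\<Phi> (c - \<delta>) + \<phi> i a \<le> \<Phi> (b - \<delta>) + \<phi> i (c - b + a)"
    and potential_eq_iff: "\<Phi> (c - \<delta>) + \<phi> i a = \<Phi> (b - \<delta>) + \<phi> i (c - b + a) \<longleftrightarrow>
           c - b + a \<in> cell (\<Delta> i) (\<phi> i) w"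
    and potential_eq_mem: "c - b + a \<in> cell (\<Delta> i) (\<phi> i) w \<Longrightarrow>
           c - \<delta> \<in> cell (\<Sum>i\<le>n. \<Delta> i) \<Phi> w"
proof -
  have i: "i \<le> n" and cell_i: "cell (\<Delta> i) (\<rho> i) v = {a}"
    using ce_row_le[OF s] ce_row_cell[OF s] by (simp_all add: i_def a_def)
  have yi: "y i = a" using s i cell_i by (auto simp: decomposes_def)
  let ?a' = "c - b + a"
  let ?y = "y(i := ?a')"
  note b = carried_point_mem[OF s w]
  have "?a' \<in> \<Delta> i" unfolding \<Delta>[OF i] using a' by (rule hull_inc)
  then have y\<Delta>: "\<And>j. j \<le> n \<Longrightarrow> ?y j \<in> \<Delta> j" using b(3) by auto
  have sumy: "(\<Sum>j\<le>n. ?y j) = c - \<delta>"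
    unfolding sum_fun_upd[OF i, of "\<lambda>j x. x" y ?a'] b(1)[symmetric] yi by simp
  have sum\<phi>: "(\<Sum>j\<le>n. \<phi> j (?y j)) = \<Phi> (b - \<delta>) - \<phi> i a + \<phi> i ?a'"
    unfolding sum_fun_upd[OF i, of \<phi> y ?a'] b(5) yi by simp
  show "\<Phi> (c - \<delta>) + \<phi> i a \<le> \<Phi> (b - \<delta>) + \<phi> i ?a'"
    using \<Phi>_le[of ?y, OF y\<Delta>] unfolding sumy sum\<phi> by simp
  have cells: "?y j \<in> cell (\<Delta> j) (\<phi> j) w" if "?a' \<in> cell (\<Delta> i) (\<phi> i) w" "j \<le> n" for j
    using that b(2) by auto
  show "c - \<delta> \<in> cell (\<Sum>i\<le>n. \<Delta> i) \<Phi> w" if "?a' \<in> cell (\<Delta> i) (\<phi> i) w"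
    using sum_mem_cell[of n ?y \<Delta> \<phi> w] cells[OF that] unfolding sumy by blast
  show "\<Phi> (c - \<delta>) + \<phi> i a = \<Phi> (b - \<delta>) + \<phi> i ?a' \<longleftrightarrow> ?a' \<in> cell (\<Delta> i) (\<phi> i) w"
  proof
    assume eq: "\<Phi> (c - \<delta>) + \<phi> i a = \<Phi> (b - \<delta>) + \<phi> i ?a'"
    obtain v' y' where s': "decomposes c v' y'" using decomposes_exists[OF c] .
    then obtain w' where w': "carries v' w'" using carries_exists[of y' v'] by (auto simp: decomposes_def)
    have mem': "?y j \<in> cell (\<Delta> j) (\<phi> j) w'" if "j \<le> n" for j
      by (rule \<phi>_summands_mem_cells[OF y\<Delta> _ _ that])
         (use eq sum\<phi> carried_point_mem(4)[OF s' w'] in \<open>simp_all add: sumy del: fun_upd_apply\<close>)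
    have "y j \<in> cell (\<Delta> j) (\<phi> j) w' \<or> cell (\<Delta> j) (\<rho> j) v = {y j}" if "j \<le> n" for j
      using mem'[OF that] cell_i yi by (cases "j = i") auto
    then have "cell (\<Delta> i) (\<phi> i) w' = cell (\<Delta> i) (\<phi> i) w"
      using carried_slope_unique[OF s w _ i] by blast
    then show "?a' \<in> cell (\<Delta> i) (\<phi> i) w" using mem'[OF i] by simp
  next
    assume "?a' \<in> cell (\<Delta> i) (\<phi> i) w"
    then have "\<Phi> (c - \<delta>) = (\<Sum>j\<le>n. \<phi> j (?y j))"
      using inf_conv_eq_of_mem_cells[of n ?y \<Delta> \<phi> w] cells unfolding sumy by blast
    then show "\<Phi> (c - \<delta>) + \<phi> i a = \<Phi> (b - \<delta>) + \<phi> i ?a'" using sum\<phi> by simp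
  qed
qed

section \<open>Blocks of the initial matrix\<close>

lemma top_cell_components:
  assumes "D \<in> top_cells n \<Delta> \<phi>"
  obtains w where "D = cell (\<Sum>i\<le>n. \<Delta> i) \<Phi> w" "D = (\<Sum>i\<le>n. cell (\<Delta> i) (\<phi> i) w)"
    "\<And>i. i \<le> n \<Longrightarrow> component n \<Delta> \<phi> D i = cell (\<Delta> i) (\<phi> i) w"
proof -
  obtain w where w: "D = cell (\<Sum>i\<le>n. \<Delta> i) \<Phi> w" and dim: "aff_dim D = int n"
    using assms by (auto simp: top_cells_def mixed_subdivision_def subdivision_def)
  have D: "D = (\<Sum>i\<le>n. cell (\<Delta> i) (\<phi> i) w)"
    unfolding w by (rule cell_eq_sum_cells[OF exact_\<phi>])
  have "D \<noteq> {}" using dim by auto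
  then obtain x where "x \<in> (\<Sum>i\<le>n. cell (\<Delta> i) (\<phi> i) w)" unfolding D by blast
  then obtain y where "\<And>i. i \<le> n \<Longrightarrow> y i \<in> cell (\<Delta> i) (\<phi> i) w"
    unfolding mem_sum_sets_iff by blast
  then have "component n \<Delta> \<phi> D i = cell (\<Delta> i) (\<phi> i) w" if "i \<le> n" for i
    unfolding w using component_eq_cell[of n y \<Delta> \<phi> w i] that by blast
  with w D show thesis using that by blast
qed

lemma top_cell_eq_sum_components:
  assumes "D \<in> top_cells n \<Delta> \<phi>"
  shows "(\<Sum>i\<le>n. component n \<Delta> \<phi> D i) = D"
proof -
  obtain w where w: "D = cell (\<Sum>i\<le>n. \<Delta> i) \<Phi> w" "D = (\<Sum>i\<le>n. cell (\<Delta> i) (\<phi> i) w)"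
    "\<And>i. i \<le> n \<Longrightarrow> component n \<Delta> \<phi> D i = cell (\<Delta> i) (\<phi> i) w"
    by (rule top_cell_components[OF assms]) (rule that; blast)
  have "(\<Sum>i\<le>n. component n \<Delta> \<phi> D i) = (\<Sum>i\<le>n. cell (\<Delta> i) (\<phi> i) w)"
    using w(3) by (intro sum.cong) auto
  then show ?thesis using w(2) by simp
qed

lemma finite_top_cells: "finite (top_cells n \<Delta> \<phi>)"
proof -
  have "top_cells n \<Delta> \<phi> \<subseteq> (\<lambda>F. \<Sum>i\<le>n. F i) ` (\<Pi>\<^sub>E i\<in>{..n}. range (cell (\<Delta> i) (\<phi> i)))"
  proof
    fix D assume D: "D \<in> top_cells n \<Delta> \<phi>"
    obtain w where "D = (\<Sum>i\<le>n. cell (\<Delta> i) (\<phi> i) w)"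
      by (rule top_cell_components[OF D]) (rule that)
    then show "D \<in> (\<lambda>F. \<Sum>i\<le>n. F i) ` (\<Pi>\<^sub>E i\<in>{..n}. range (cell (\<Delta> i) (\<phi> i)))"
      by (intro image_eqI[of _ _ "restrict (\<lambda>i. cell (\<Delta> i) (\<phi> i) w) {..n}"]) (auto cong: sum.cong_simp)
  qed
  moreover have "finite ((\<lambda>F. \<Sum>i\<le>n. F i) ` (\<Pi>\<^sub>E i\<in>{..n}. range (cell (\<Delta> i) (\<phi> i))))"
    using finite_cells[OF piecewise] by (intro finite_imageI[OF finite_PiE]) auto
  ultimately show ?thesis by (rule finite_subset)
qed

definition block :: "'a set \<Rightarrow> 'a set" where
  "block D = ce_index n M (component n \<Delta> \<phi> D) \<delta>"

lemma block_eq: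
  assumes "D \<in> top_cells n \<Delta> \<phi>"
  shows "block D = {b \<in> ce_index n M \<Delta> \<delta>. b - \<delta> \<in> D}"
proof -
  have "D \<subseteq> (\<Sum>i\<le>n. \<Delta> i)" using top_cell_components[OF assms] cell_subset by metis
  then show ?thesis
    unfolding block_def ce_index_def top_cell_eq_sum_components[OF assms] by force
qed

lemma component_eq_carried_cell:
  assumes D: "D \<in> top_cells n \<Delta> \<phi>" and b: "b \<in> block D"
    and s: "decomposes b v y" and w: "carries v w" and i: "i \<le> n"
  shows "component n \<Delta> \<phi> D i = cell (\<Delta> i) (\<phi> i) w"
proof -
  obtain w' where w': "D = cell (\<Sum>i\<le>n. \<Delta> i) \<Phi> w'"
    "\<And>i. i \<le> n \<Longrightarrow> component n \<Delta> \<phi> D i = cell (\<Delta> i) (\<phi> i) w'"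
    using top_cell_components[OF D] by metis
  note p = carried_point_mem[OF s w]
  have "b - \<delta> \<in> D" using b block_eq[OF D] by blast
  then have "y j \<in> cell (\<Delta> j) (\<phi> j) w'" if "j \<le> n" for j
    using \<phi>_summands_mem_cells[OF p(3) _ _ that, of w'] p(1,5) w'(1) by simp
  then have "cell (\<Delta> i) (\<phi> i) w' = cell (\<Delta> i) (\<phi> i) w"
    using carried_slope_unique[OF s w _ i] by blast
  then show ?thesis using w'(2)[OF i] by simp
qed

lemma index_frame:
  assumes "b \<in> ce_index n M \<Delta> \<delta>"
  obtains v y w where "decomposes b v y" "carries v w"
proof -
  obtain v y where s: "decomposes b v y" using decomposes_exists[OF assms] .
  then obtain w where "carries v w" using carries_exists[of y v] by (auto simp: decomposes_def)
  with s show thesis using that by blast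
qed

text \<open>
  The components of a cell through \<open>b - \<delta>\<close> are determined by \<open>b\<close>, and the cell is their sum.
\<close>
lemma block_disjoint:
  assumes D: "D \<in> top_cells n \<Delta> \<phi>" "E \<in> top_cells n \<Delta> \<phi>" and b: "b \<in> block D" "b \<in> block E"
  shows "D = E"
proof -
  have "b \<in> ce_index n M \<Delta> \<delta>" using b(1) block_eq[OF D(1)] by blast
  then obtain v y w where f: "decomposes b v y" "carries v w" by (rule index_frame)
  have "component n \<Delta> \<phi> D i = component n \<Delta> \<phi> E i" if "i \<le> n" for i
    using component_eq_carried_cell[OF D(1) b(1) f that] component_eq_carried_cell[OF D(2) b(2) f that]
    by simp
  then have "(\<Sum>i\<le>n. component n \<Delta> \<phi> D i) = (\<Sum>i\<le>n. component n \<Delta> \<phi> E i)"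
    by (intro sum.cong) auto
  then show ?thesis using top_cell_eq_sum_components D by simp
qed

lemma blocks_cover: "(\<Union>D\<in>top_cells n \<Delta> \<phi>. block D) = ce_index n M \<Delta> \<delta>"
proof
  show "(\<Union>D\<in>top_cells n \<Delta> \<phi>. block D) \<subseteq> ce_index n M \<Delta> \<delta>"
    using block_eq by blast
next
  show "ce_index n M \<Delta> \<delta> \<subseteq> (\<Union>D\<in>top_cells n \<Delta> \<phi>. block D)"
  proof
    fix b assume b: "b \<in> ce_index n M \<Delta> \<delta>"
    then obtain v y w where f: "decomposes b v y" "carries v w" by (rule index_frame)
    let ?D = "cell (\<Sum>i\<le>n. \<Delta> i) \<Phi> w" and ?C = "cell (\<Sum>i\<le>n. \<Delta> i) (inf_conv n \<Delta> \<rho>) v"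
    have mem: "b - \<delta> \<in> ?D" by (rule carried_point_mem(4)[OF f])
    have "b - \<delta> \<in> ?C"
      using f(1) sum_mem_cell[of n y \<Delta> \<rho> v] unfolding carried_point_mem(1)[OF f] by (auto simp: decomposes_def)
    then have "int n \<le> aff_dim ?C"
      using generic_cell_dim[of ?C "b - \<delta>"] f(1)
      by (auto simp: decomposes_def mixed_subdivision_def subdivision_def)
    also have "?C \<subseteq> ?D"
      unfolding cell_eq_sum_cells[OF exact_\<rho>] cell_eq_sum_cells[OF exact_\<phi>]
      using f(2) by (intro sum_sets_mono) (auto simp: carries_def)
    then have "aff_dim ?C \<le> aff_dim ?D" by (rule aff_dim_subset)
    finally have "int n \<le> aff_dim ?D" .
    moreover have "?D \<subseteq> span M" using cell_subset sum_subset_span[of \<Delta>] by blast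
    then have "aff_dim ?D \<le> int n"
      using aff_dim_subset[of ?D "span M"] lattice_dim[OF lattice]
      by (simp add: aff_dim_subspace subspace_span)
    ultimately have "?D \<in> top_cells n \<Delta> \<phi>"
      by (auto simp: top_cells_def mixed_subdivision_def subdivision_def)
    then show "b \<in> (\<Union>D\<in>top_cells n \<Delta> \<phi>. block D)" using block_eq mem b by blast
  qed
qed

text \<open>
  An optimal sum for \<open>\<rho>\<close> is optimal for \<open>\<phi>\<close> as well. If the sum lies in \<open>D\<close>, its summands therefore
  lie in the components of \<open>D\<close>, even when the sum is on the boundary of \<open>D\<close>.
\<close>
lemma exact_\<rho>_component:
  assumes D: "D \<in> top_cells n \<Delta> \<phi>"
  shows "exact_sum n (component n \<Delta> \<phi> D) \<rho>"
  unfolding exact_sum_def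
proof
  obtain w0 where w0: "D = cell (\<Sum>i\<le>n. \<Delta> i) \<Phi> w0"
    "\<And>i. i \<le> n \<Longrightarrow> component n \<Delta> \<phi> D i = cell (\<Delta> i) (\<phi> i) w0"
    using top_cell_components[OF D] by metis
  fix x assume "x \<in> (\<Sum>i\<le>n. component n \<Delta> \<phi> D i)"
  then have x: "x \<in> D" using top_cell_eq_sum_components[OF D] by simp
  then have "x \<in> (\<Sum>i\<le>n. \<Delta> i)" using w0(1) cell_subset by blast
  then obtain v y where y: "\<And>i. i \<le> n \<Longrightarrow> y i \<in> cell (\<Delta> i) (\<rho> i) v" "(\<Sum>i\<le>n. y i) = x"
    using exact_\<rho> unfolding exact_sum_def by blast
  obtain w where w: "carries v w" using carries_exists y(1) by blast
  have "y i \<in> cell (component n \<Delta> \<phi> D i) (\<rho> i) v" if i: "i \<le> n" for i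
  proof -
    have "y i \<in> cell (\<Delta> i) (\<phi> i) w0"
    proof (rule \<phi>_summands_mem_cells[OF _ _ _ i])
      show "y j \<in> \<Delta> j" if "j \<le> n" for j using y(1)[OF that] cell_subset by blast
      show "\<Phi> (\<Sum>i\<le>n. y i) = (\<Sum>i\<le>n. \<phi> i (y i))"
        by (rule inf_conv_eq_of_mem_cells) (rule carriesD[OF w _ y(1)])
      show "(\<Sum>i\<le>n. y i) \<in> cell (\<Sum>i\<le>n. \<Delta> i) \<Phi> w0" using x y(2) w0(1) by simp
    qed
    then show ?thesis
      unfolding w0(2)[OF i] using y(1)[OF i] cell_subset[of "\<Delta> i" "\<phi> i" w0] by (auto simp: cell_def)
  qed
  then show "\<exists>v y. (\<forall>i\<le>n. y i \<in> cell (component n \<Delta> \<phi> D i) (\<rho> i) v) \<and> (\<Sum>i\<le>n. y i) = x"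
    by (intro exI[of _ v] exI[of _ y] conjI y(2)) blast
qed

definition column_point :: "'a \<Rightarrow> 'a \<Rightarrow> 'a" where
  "column_point b c = c - b + ce_point n \<Delta> \<rho> \<delta> b"

abbreviation row :: "'a \<Rightarrow> nat" where "row \<equiv> ce_row n \<Delta> \<rho> \<delta>"

definition entry :: "'a \<Rightarrow> 'a \<Rightarrow> bool" where
  "entry b c \<longleftrightarrow> column_point b c \<in> A (row b)"

text \<open>
  Equality in the potential inequality; \<open>column_point b b\<close> is the row point of \<open>b\<close>.
\<close>
definition initial_entry :: "'a \<Rightarrow> 'a \<Rightarrow> bool" where
  "initial_entry b c \<longleftrightarrow> entry b c \<and>
     \<phi> (row b) (column_point b c) = \<phi> (row b) (column_point b b) + \<Phi> (c - \<delta>) - \<Phi> (b - \<delta>)"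

lemma entry_diag:
  assumes "b \<in> ce_index n M \<Delta> \<delta>"
  shows "entry b b"
proof -
  obtain v y where "decomposes b v y" using decomposes_exists[OF assms] .
  then show ?thesis using ce_point_mem by (auto simp: entry_def column_point_def)
qed

lemma initial_entry_iff:
  assumes D: "D \<in> top_cells n \<Delta> \<phi>" and b: "b \<in> block D" and c: "c \<in> ce_index n M \<Delta> \<delta>"
  shows "initial_entry b c \<longleftrightarrow> column_point b c \<in> A (row b) \<inter> component n \<Delta> \<phi> D (row b)"
    and "initial_entry b c \<Longrightarrow> c \<in> block D"
proof -
  have "b \<in> ce_index n M \<Delta> \<delta>" using b block_eq[OF D] by blast
  then obtain v y w where f: "decomposes b v y" "carries v w" by (rule index_frame)
  have comp: "component n \<Delta> \<phi> D i = cell (\<Delta> i) (\<phi> i) w" if "i \<le> n" for i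
    by (rule component_eq_carried_cell[OF D b f that])
  show iff: "initial_entry b c \<longleftrightarrow> column_point b c \<in> A (row b) \<inter> component n \<Delta> \<phi> D (row b)"
  proof (cases "entry b c")
    case True
    then have mem: "c - b + ce_point n \<Delta> \<rho> \<delta> b \<in> A (row b)"
      by (simp add: entry_def column_point_def)
    have "initial_entry b c \<longleftrightarrow> \<Phi> (c - \<delta>) + \<phi> (row b) (ce_point n \<Delta> \<rho> \<delta> b) =
        \<Phi> (b - \<delta>) + \<phi> (row b) (c - b + ce_point n \<Delta> \<rho> \<delta> b)"
      by (simp only: initial_entry_def column_point_def True simp_thms diff_self add_0)
         (rule iffI; linarith)
    then show ?thesis
      unfolding potential_eq_iff[OF f c mem] comp[OF ce_row_le[OF f(1)]]
      using mem by (simp add: column_point_def)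
  next
    case False
    then show ?thesis by (simp add: initial_entry_def entry_def)
  qed
  assume "initial_entry b c"
  then have "c - b + ce_point n \<Delta> \<rho> \<delta> b \<in> A (row b)"
    "c - b + ce_point n \<Delta> \<rho> \<delta> b \<in> cell (\<Delta> (row b)) (\<phi> (row b)) w"
    unfolding iff comp[OF ce_row_le[OF f(1)]] by (simp_all add: column_point_def)
  then have "c - \<delta> \<in> cell (\<Sum>i\<le>n. \<Delta> i) \<Phi> w" by (rule potential_eq_mem[OF f c])
  also have "\<dots> = (\<Sum>i\<le>n. component n \<Delta> \<phi> D i)"
    unfolding cell_eq_sum_cells[OF exact_\<phi>] by (intro sum.cong) (auto simp: comp)
  finally show "c \<in> block D" unfolding top_cell_eq_sum_components[OF D] using block_eq[OF D] c by blast
qed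

lemma ce_matrix_eq: "ce_matrix n \<Delta> A \<rho> \<delta> = var_matrix entry (\<lambda>b c. (row b, column_point b c))"
  by (intro ext) (simp add: ce_matrix_def var_matrix_def entry_def column_point_def Let_def)

lemma det_block:
  assumes D: "D \<in> top_cells n \<Delta> \<phi>"
  shows "det_on (block D) (var_matrix initial_entry (\<lambda>b c. (row b, column_point b c))) =
    ce_det n M (component n \<Delta> \<phi> D) (\<lambda>i. A i \<inter> component n \<Delta> \<phi> D i) \<rho> \<delta>"
  unfolding ce_det_def block_def[symmetric]
proof (rule det_on_cong)
  fix b c assume b: "b \<in> block D" and c: "c \<in> block D"
  have "b \<in> ce_index n M \<Delta> \<delta>" "c \<in> ce_index n M \<Delta> \<delta>" using b c block_eq[OF D] by blast+
  then obtain v y w where f: "decomposes b v y" "carries v w" using index_frame by blast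
  have comp: "component n \<Delta> \<phi> D i = cell (\<Delta> i) (\<phi> i) w" if "i \<le> n" for i
    by (rule component_eq_carried_cell[OF D b f that])
  have "component n \<Delta> \<phi> D i \<subseteq> \<Delta> i" "cell (\<Delta> i) (\<rho> i) v \<subseteq> component n \<Delta> \<phi> D i" if "i \<le> n" for i
    unfolding comp[OF that] using f(2) that by (auto simp: carries_def cell_subset)
  then have "ce_row n (component n \<Delta> \<phi> D) \<rho> \<delta> b = row b"
    "ce_point n (component n \<Delta> \<phi> D) \<rho> \<delta> b = ce_point n \<Delta> \<rho> \<delta> b"
    using ce_row_restrict[OF f(1) _ _ exact_\<rho>_component[OF D]] by auto
  then show "var_matrix initial_entry (\<lambda>b c. (row b, column_point b c)) b c =
      ce_matrix n (component n \<Delta> \<phi> D) (\<lambda>i. A i \<inter> component n \<Delta> \<phi> D i) \<rho> \<delta> b c"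
    using initial_entry_iff(1)[OF D b \<open>c \<in> ce_index n M \<Delta> \<delta>\<close>]
    by (simp add: ce_matrix_def var_matrix_def column_point_def Let_def)
qed

lemma det_initial_entries:
  "det_on (ce_index n M \<Delta> \<delta>) (var_matrix initial_entry (\<lambda>b c. (row b, column_point b c))) =
   (\<Prod>D\<in>top_cells n \<Delta> \<phi>.
      ce_det n M (component n \<Delta> \<phi> D) (\<lambda>i. A i \<inter> component n \<Delta> \<phi> D i) \<rho> \<delta>)"
proof -
  have fin: "finite (ce_index n M \<Delta> \<delta>)" by (rule finite_index) simp
  have "det_on (\<Union>D\<in>top_cells n \<Delta> \<phi>. block D)
      (var_matrix initial_entry (\<lambda>b c. (row b, column_point b c))) =
    (\<Prod>D\<in>top_cells n \<Delta> \<phi>. det_on (block D)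
      (var_matrix initial_entry (\<lambda>b c. (row b, column_point b c))))"
  proof (rule det_on_UN_block[OF finite_top_cells])
    show "finite (block D)" if "D \<in> top_cells n \<Delta> \<phi>" for D
      using fin block_eq[OF that] by simp
    show "block D \<inter> block E = {}" if "D \<in> top_cells n \<Delta> \<phi>" "E \<in> top_cells n \<Delta> \<phi>" "D \<noteq> E" for D E
      using block_disjoint that by blast
    fix D E b c assume *: "D \<in> top_cells n \<Delta> \<phi>" "E \<in> top_cells n \<Delta> \<phi>" "D \<noteq> E" "b \<in> block D" "c \<in> block E"
    have "c \<in> ce_index n M \<Delta> \<delta>" "c \<notin> block D"
      using * block_eq[of E] block_disjoint[of D E c] by blast+
    then have "\<not> initial_entry b c" using initial_entry_iff(2)[of D b c] * by blast
    then show "var_matrix initial_entry (\<lambda>b c. (row b, column_point b c)) b c = 0"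
      by (simp add: var_matrix_def)
  qed
  then show ?thesis by (simp add: blocks_cover det_block)
qed

end

theorem theorem1p2:
  fixes n :: nat
    and M :: "'a::euclidean_space set"
    and A \<Delta> :: "nat \<Rightarrow> 'a set"
    and \<rho> \<phi> :: "nat \<Rightarrow> 'a \<Rightarrow> real"
    and \<delta> :: 'a
  assumes "lattice_of_rank n M"
    and "\<And>i. i \<le> n \<Longrightarrow> A i \<noteq> {} \<and> finite (A i) \<and> A i \<subseteq> M"
    and "\<And>i. i \<le> n \<Longrightarrow> \<Delta> i = convex hull (A i)"
    and "\<And>i. i \<le> n \<Longrightarrow> convex_piecewise_affine_on (\<Delta> i) (\<rho> i)"
    and "\<And>i. i \<le> n \<Longrightarrow> defined_on_support (A i) (\<rho> i)"
    and "tight_mixed n \<Delta> \<rho>"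
    and "\<delta> \<in> span M"
    and "generic_shift n M \<Delta> \<rho> \<delta>"
    and "\<And>i. i \<le> n \<Longrightarrow> convex_piecewise_affine_on (\<Delta> i) (\<phi> i)"
    and "coarser n \<Delta> \<phi> \<rho>"
  shows "init_part (\<lambda>(i, a). \<phi> i a) (ce_det n M \<Delta> A \<rho> \<delta>) =
         (\<Prod>D\<in>top_cells n \<Delta> \<phi>.
            ce_det n M (component n \<Delta> \<phi> D) (\<lambda>i. A i \<inter> component n \<Delta> \<phi> D i) \<rho> \<delta>)"
proof -
  interpret ce_coarsening n M A \<Delta> \<rho> \<delta> \<phi>
    by unfold_locales (use assms in blast)+
  \<comment> \<open>the subdivision of \<open>\<rho>\<close> is coarser than itself, which gives the second grading\<close>
  interpret self: ce_coarsening n M A \<Delta> \<rho> \<delta> \<rho>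
    by unfold_locales (use assms in \<open>auto simp: coarser_def\<close>)
  let ?B = "ce_index n M \<Delta> \<delta>"
  have "init_part (\<lambda>(i, a). \<phi> i a) (det_on ?B (var_matrix entry (\<lambda>b c. (row b, column_point b c)))) =
    det_on ?B (var_matrix (\<lambda>b c. entry b c \<and> (case (row b, column_point b c) of (i, a) \<Rightarrow> \<phi> i a) =
        \<phi> (row b) (column_point b b) + \<Phi> (c - \<delta>) - \<Phi> (b - \<delta>)) (\<lambda>b c. (row b, column_point b c)))"
  proof (rule init_part_det_potential[where \<omega>' = "\<lambda>(i, a). \<rho> i a"
        and r' = "\<lambda>b. \<rho> (row b) (column_point b b)" and h' = "\<lambda>b. self.\<Phi> (b - \<delta>)"])
    show "finite ?B" by (rule finite_index) simp
  next
    fix b c assume b: "b \<in> ?B" and c: "c \<in> ?B" and E: "entry b c"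
    obtain v y w where f: "decomposes b v y" "carries v w" using b by (rule index_frame)
    \<comment> \<open>slope \<open>v\<close> carries itself, and its component at the row index is the row point alone\<close>
    have f': "self.carries v v" by (simp add: self.carries_def)
    show "\<phi> (row b) (column_point b b) + \<Phi> (c - \<delta>) - \<Phi> (b - \<delta>) \<le>
        (case (row b, column_point b c) of (i, a) \<Rightarrow> \<phi> i a)"
      using potential_le[OF f c] E by (auto simp: entry_def column_point_def)
    show "\<rho> (row b) (column_point b b) + self.\<Phi> (c - \<delta>) - self.\<Phi> (b - \<delta>) \<le>
        (case (row b, column_point b c) of (i, a) \<Rightarrow> \<rho> i a)"
      using self.potential_le[OF f(1) f' c] E by (auto simp: entry_def column_point_def)
    assume "(case (row b, column_point b c) of (i, a) \<Rightarrow> \<rho> i a) =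
      \<rho> (row b) (column_point b b) + self.\<Phi> (c - \<delta>) - self.\<Phi> (b - \<delta>)"
    then have "column_point b c \<in> cell (\<Delta> (row b)) (\<rho> (row b)) v"
      using self.potential_eq_iff[OF f(1) f' c] E by (auto simp: entry_def column_point_def)
    then show "c = b" unfolding ce_row_cell[OF f(1)] by (simp add: column_point_def)
  qed (auto simp: entry_diag)
  then show ?thesis
    unfolding ce_det_def ce_matrix_eq det_initial_entries[symmetric, unfolded ce_det_def]
    by (simp add: initial_entry_def[abs_def])
qed

end
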